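(* Let the setting and standing assumptions in the context hold, and let $T\ge1$ be the total number of iterations. Choose the parameters, for all $t$, $$\gamma_t=\gamma\ge L,\qquad 0<\alpha_t=\alpha\le\frac{\gamma\lambda}{8(\gamma\Psi_1+\Psi_2)},\qquad|\mathcal B_t|=|\mathcal B|.$$ Then the sequence $\{x_t\}_{t\ge0}$ generated by the stochastic projection-based Riemannian Bregman gradient method (described in the context) satisfies $$\frac1T\sum_{t=0}^{T-1}\mathbb E\left[\|v_t^{\mathcal P}\|^2\right]\ \le\ \mathcal O\!\left(\frac{F(x_0)-F^*}{T}+\frac{\sigma^2}{|\mathcal B|}\right),$$ where the expectation is over all the randomness and the constant hidden in $\mathcal O(\cdot)$ is independent of $T$, $|\mathcal B|$, $\sigma$ and $x_0$.
   Context: Setting. $\mathcal M\subseteq\mathbb R^n$ is a compact $C^\infty$ embedded submanifold endowed with the Euclidean inner product on each tangent space $\mathcal T_x\mathcal M\subseteq\mathbb R^n$; $\mathcal N_x\mathcal M$ is the orthogonal complement of $\mathcal T_x\mathcal M$. The problem is $\min_{x\in\mathcal M}F(x)$, $F=f$ (no nonsmooth term), $f(x)=\mathbb E_\pi[f(x,\pi)]$, with $f:\mathbb R^n\to\mathbb R$ continuously differentiable; $F^*=\inf_{\mathcal M}F>-\infty$. Assumptions. $h:\mathbb R^n\to\mathbb R$ is twice continuously differentiable and $\lambda$-strongly convex, $\lambda>0$, with Bregman distance $D_h(y,x)=h(y)-h(x)-\langle\nabla h(x),y-x\rangle$. The function $f$ is $L$-smooth relative to $h$ ($L>0$): $f(y)\le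 f(x)+\langle\nabla f(x),y-x\rangle+L\,D_h(y,x)$ for all $x,y\in\mathbb R^n$. The stochastic oracle satisfies, for all $x\in\mathbb R^n$, $\mathbb E_\pi[\nabla f(x,\pi)]=\nabla f(x)$ and $\mathbb E_\pi[\|\nabla f(x,\pi)-\nabla f(x)\|^2]\le\sigma^2$, $\sigma>0$. Constants. $G_f=\max_{\mathcal M}\|\nabla f\|$, $G_h=\max_{\mathcal M}\|\nabla h\|$, $H_h=\max_{\mathcal M}\|\nabla^2h\|$. $\mathcal P_{\mathcal M}$ is the nearest-point projection onto $\mathcal M$. Since $\mathcal M$ is compact, there are $\varrho>0$ and $M_1^{\mathcal P},M_2^{\mathcal P},M_3^{\mathcal P}>0$ such that for all $x\in\mathcal M$, $v\in\mathcal T_x\mathcal M$, $u\in\mathcal N_x\mathcal M$ with $\|u\|\le\varrho/2$: $\|\mathcal P_{\mathcal M}(x+v+u)-x\|\le M_1^{\mathcal P}\|v\|$ and $\|\mathcal P_{\mathcal M}(x+v+u)-x-v\|\le M_2^{\mathcal P}\|v\|^2+M_3^{\mathcal P}\|v\|\|u\|$. Also $M_4^{\mathcal P}>0$ is such that $\|\mathcal P_{\mathcal N_x\mathcal M}(x-y)\|\le M_4^{\mathcal P}\|x-y\|^2$ for all $x,y\in\mathcal M$, where $\mathcal P_{\mathcal N_x\mathcal M}$ is the orthogonal projection onto $\mathcal N_x\mathcal M$. Define $\Psi_1=2G_h(M_2^{\mathcal P}+M_3^{\mathcal P})+H_h$ and $\Psi_2=\left((M_2^{\mathcal P}+M_3^{\mathcal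 P})+(M_1^{\mathcal P})^2M_4^{\mathcal P}\right)G_f$. Algorithm (stochastic projection-based method). Given $x_0\in\mathcal M$, for $t=0,1,\dots$: draw a fresh mini-batch $\mathcal B_t$ of i.i.d. samples $\pi_t^{(j)}$ (independent of the past), set $\nabla f_{\mathcal B_t}(x_t)=\frac1{|\mathcal B_t|}\sum_{j\in\mathcal B_t}\nabla f(x_t,\pi_t^{(j)})$ and let $\operatorname{grad} f_{\mathcal B_t}(x_t)$ be its orthogonal projection onto $\mathcal T_{x_t}\mathcal M$; compute $$\zeta_t^{\mathcal P}=\arg\min_{\zeta\in\mathbb R^n}\langle\operatorname{grad} f_{\mathcal B_t}(x_t),\zeta\rangle+\gamma_tD_h(x_t+\zeta,x_t),$$ and set $x_{t+1}=\mathcal P_{\mathcal M}(x_t+\alpha_t\zeta_t^{\mathcal P})$. Stationarity measure. $v_t^{\mathcal P}=\arg\min_{v\in\mathbb R^n}\langle\operatorname{grad} f(x_t),v\rangle+\gamma_tD_h(x_t+v,x_t)$, with $\operatorname{grad} f(x_t)$ the orthogonal projection of $\nabla f(x_t)$ onto $\mathcal T_{x_t}\mathcal M$. *)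

theory Defs
  imports "HOL-Probability.Probability"
begin

definition gradient :: "('a::real_inner \<Rightarrow> real) \<Rightarrow> 'a \<Rightarrow> 'a" where
  "gradient f x = (THE g. GDERIV f x :> g)"

definition hessian :: "('a::real_inner \<Rightarrow> real) \<Rightarrow> 'a \<Rightarrow> 'a \<Rightarrow> 'a" where
  "hessian f x = frechet_derivative (gradient f) (at x)"

text \<open>\<open>Ck_on k S f\<close>: all iterated directional derivatives of \<open>f\<close> up to order \<open>k\<close>
  exist (as Frechet derivatives) and are continuous on \<open>S\<close>.  Only used for open \<open>S\<close> in
  finite-dimensional spaces, where this is the usual class \<open>C\<^sup>k\<close>.\<close>

primrec Ck_on :: "nat \<Rightarrow> 'a::real_normed_vector set \<Rightarrow> ('a \<Rightarrow> 'b::real_normed_vector) \<Rightarrow> bool" where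
  "Ck_on 0 S f \<longleftrightarrow> continuous_on S f"
| "Ck_on (Suc k) S f \<longleftrightarrow>
     (\<forall>x\<in>S. f differentiable (at x)) \<and> (\<forall>v. Ck_on k S (\<lambda>x. frechet_derivative f (at x) v))"

definition smooth_on :: "'a::real_normed_vector set \<Rightarrow> ('a \<Rightarrow> 'b::real_normed_vector) \<Rightarrow> bool" where
  "smooth_on S f \<longleftrightarrow> (\<forall>k. Ck_on k S f)"

definition strongly_convex :: "real \<Rightarrow> ('a::real_inner \<Rightarrow> real) \<Rightarrow> bool" where
  "strongly_convex m h \<longleftrightarrow> convex_on UNIV (\<lambda>x. h x - m / 2 * (norm x)\<^sup>2)"

definition bregman :: "('a::real_inner \<Rightarrow> real) \<Rightarrow> 'a \<Rightarrow> 'a \<Rightarrow> real" where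
  "bregman h y x = h y - h x - gradient h x \<bullet> (y - x)"

definition relatively_smooth :: "real \<Rightarrow> ('a::real_inner \<Rightarrow> real) \<Rightarrow> ('a \<Rightarrow> real) \<Rightarrow> bool" where
  "relatively_smooth L h f \<longleftrightarrow>
     (\<forall>x y. f y \<le> f x + gradient f x \<bullet> (y - x) + L * bregman h y x)"

text \<open>Slice charts: near each of its points, \<open>M\<close> is carried by a smooth diffeomorphism between
  open subsets of the ambient space onto an open piece of a \<open>d\<close>-dimensional linear subspace.\<close>

definition embedded_submanifold :: "nat \<Rightarrow> 'a::euclidean_space set \<Rightarrow> bool" where
  "embedded_submanifold d M \<longleftrightarrow>
     (\<forall>x\<in>M. \<exists>U V \<phi> \<psi> (W :: 'a set).
        open U \<and> x \<in> U \<and> open V \<and> homeomorphism U V \<phi> \<psi> \<and> smooth_on U \<phi> \<and> smooth_on V \<psi> \<and>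
        subspace W \<and> dim W = d \<and> \<phi> ` (U \<inter> M) = V \<inter> W)"

definition tangent_space :: "'a::euclidean_space set \<Rightarrow> 'a \<Rightarrow> 'a set" where
  "tangent_space M x =
     {v. \<exists>c \<epsilon>. \<epsilon> > 0 \<and> smooth_on {-\<epsilon><..<\<epsilon>} c \<and> c ` {-\<epsilon><..<\<epsilon>} \<subseteq> M \<and> c 0 = x \<and>
           (c has_vector_derivative v) (at (0::real))}"

definition normal_space :: "'a::euclidean_space set \<Rightarrow> 'a \<Rightarrow> 'a set" where
  "normal_space M x = orthogonal_comp (tangent_space M x)"

definition orth_proj :: "'a::euclidean_space set \<Rightarrow> 'a \<Rightarrow> 'a" where
  "orth_proj S w = (THE p. p \<in> S \<and> w - p \<in> orthogonal_comp S)"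

text \<open>The nearest point of \<open>M\<close> need not be unique, so the projection is any selection of nearest
  points; it is required to be Borel so that the iterates are random variables.\<close>

definition nearest_point_projection :: "'a::euclidean_space set \<Rightarrow> ('a \<Rightarrow> 'a) \<Rightarrow> bool" where
  "nearest_point_projection M P \<longleftrightarrow>
     P \<in> borel_measurable borel \<and> (\<forall>z. P z \<in> M \<and> (\<forall>y\<in>M. dist z (P z) \<le> dist z y))"

definition projection_constants ::
    "'a::euclidean_space set \<Rightarrow> ('a \<Rightarrow> 'a) \<Rightarrow> real \<Rightarrow> real \<Rightarrow> real \<Rightarrow> real \<Rightarrow> real \<Rightarrow> bool" where
  "projection_constants M P \<rho> M1 M2 M3 M4 \<longleftrightarrow>
     \<rho> > 0 \<and> M1 > 0 \<and> M2 > 0 \<and> M3 > 0 \<and> M4 > 0 \<and>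
     (\<forall>x\<in>M. \<forall>v\<in>tangent_space M x. \<forall>u\<in>normal_space M x. norm u \<le> \<rho> / 2 \<longrightarrow>
        norm (P (x + v + u) - x) \<le> M1 * norm v \<and>
        norm (P (x + v + u) - x - v) \<le> M2 * (norm v)\<^sup>2 + M3 * norm v * norm u) \<and>
     (\<forall>x\<in>M. \<forall>y\<in>M. norm (orth_proj (normal_space M x) (x - y)) \<le> M4 * (norm (x - y))\<^sup>2)"

text \<open>For compact nonempty \<open>M\<close> and continuous \<open>\<nabla>f\<close>, \<open>\<nabla>h\<close>, \<open>\<nabla>\<^sup>2h\<close> the suprema below are maxima.\<close>

definition max_grad_norm :: "'a::euclidean_space set \<Rightarrow> ('a \<Rightarrow> real) \<Rightarrow> real" where
  "max_grad_norm M f = (SUP x\<in>M. norm (gradient f x))"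

definition max_hess_norm :: "'a::euclidean_space set \<Rightarrow> ('a \<Rightarrow> real) \<Rightarrow> real" where
  "max_hess_norm M h = (SUP x\<in>M. onorm (hessian h x))"

definition Psi1 :: "'a::euclidean_space set \<Rightarrow> ('a \<Rightarrow> real) \<Rightarrow> real \<Rightarrow> real \<Rightarrow> real" where
  "Psi1 M h M2 M3 = 2 * max_grad_norm M h * (M2 + M3) + max_hess_norm M h"

definition Psi2 ::
    "'a::euclidean_space set \<Rightarrow> ('a \<Rightarrow> real) \<Rightarrow> real \<Rightarrow> real \<Rightarrow> real \<Rightarrow> real \<Rightarrow> real" where
  "Psi2 M f M1 M2 M3 M4 = ((M2 + M3) + M1\<^sup>2 * M4) * max_grad_norm M f"

text \<open>\<open>F x p\<close> is the sample function \<open>f(x,\<pi>)\<close>, and \<open>D\<close> the law of \<open>\<pi>\<close>.\<close>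

definition sample_grad :: "('a::euclidean_space \<Rightarrow> 'p \<Rightarrow> real) \<Rightarrow> 'a \<Rightarrow> 'p \<Rightarrow> 'a" where
  "sample_grad F x p = gradient (\<lambda>y. F y p) x"

definition stochastic_oracle ::
    "'p measure \<Rightarrow> ('a::euclidean_space \<Rightarrow> 'p \<Rightarrow> real) \<Rightarrow> ('a \<Rightarrow> real) \<Rightarrow> real \<Rightarrow> bool" where
  "stochastic_oracle D F f \<sigma> \<longleftrightarrow>
     prob_space D \<and>
     (\<forall>p\<in>space D. \<forall>x. (\<lambda>y. F y p) differentiable (at x)) \<and>
     (\<forall>x. has_bochner_integral D (F x) (f x)) \<and>
     (\<forall>x. has_bochner_integral D (sample_grad F x) (gradient f x)) \<and>
     (\<forall>x. integrable D (\<lambda>p. (norm (sample_grad F x p - gradient f x))\<^sup>2) \<and>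
          (\<integral>p. (norm (sample_grad F x p - gradient f x))\<^sup>2 \<partial>D) \<le> \<sigma>\<^sup>2)"

text \<open>\<open>\<xi> t j\<close> is the \<open>j\<close>-th sample of the batch of size \<open>b t\<close> drawn in iteration \<open>t\<close>.  Since the
  initial point is deterministic, joint independence of all the samples makes every batch
  independent of the past.\<close>

definition iid_samples ::
    "'w measure \<Rightarrow> 'p measure \<Rightarrow> (nat \<Rightarrow> nat) \<Rightarrow> (nat \<Rightarrow> nat \<Rightarrow> 'w \<Rightarrow> 'p) \<Rightarrow> bool" where
  "iid_samples \<Omega> D b \<xi> \<longleftrightarrow>
     prob_space \<Omega> \<and>
     prob_space.indep_vars \<Omega> (\<lambda>_. D) (\<lambda>(t, j). \<xi> t j) (SIGMA t:UNIV. {..<b t}) \<and>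
     (\<forall>t. \<forall>j<b t. distr \<Omega> D (\<xi> t j) = D)"

definition batch_grad ::
    "('a::euclidean_space \<Rightarrow> 'p \<Rightarrow> real) \<Rightarrow> nat \<Rightarrow> (nat \<Rightarrow> 'p) \<Rightarrow> 'a \<Rightarrow> 'a" where
  "batch_grad F b p x = (1 / real b) *\<^sub>R (\<Sum>j<b. sample_grad F x (p j))"

definition bregman_step :: "('a::euclidean_space \<Rightarrow> real) \<Rightarrow> real \<Rightarrow> 'a \<Rightarrow> 'a \<Rightarrow> 'a" where
  "bregman_step h \<gamma> g x = arg_min (\<lambda>\<zeta>. g \<bullet> \<zeta> + \<gamma> * bregman h (x + \<zeta>) x) (\<lambda>_. True)"

primrec iterate ::
    "'a::euclidean_space set \<Rightarrow> ('a \<Rightarrow> 'a) \<Rightarrow> ('a \<Rightarrow> real) \<Rightarrow> ('a \<Rightarrow> 'p \<Rightarrow> real) \<Rightarrow>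
     (nat \<Rightarrow> real) \<Rightarrow> (nat \<Rightarrow> real) \<Rightarrow> (nat \<Rightarrow> nat) \<Rightarrow> (nat \<Rightarrow> nat \<Rightarrow> 'w \<Rightarrow> 'p) \<Rightarrow>
     'a \<Rightarrow> nat \<Rightarrow> 'w \<Rightarrow> 'a" where
  "iterate M P h F \<gamma> \<alpha> b \<xi> x0 0 \<omega> = x0"
| "iterate M P h F \<gamma> \<alpha> b \<xi> x0 (Suc t) \<omega> =
     (let x = iterate M P h F \<gamma> \<alpha> b \<xi> x0 t \<omega>;
          g = orth_proj (tangent_space M x) (batch_grad F (b t) (\<lambda>j. \<xi> t j \<omega>) x)
      in P (x + \<alpha> t *\<^sub>R bregman_step h (\<gamma> t) g x))"

text \<open>The step \<open>v\<close> at \<open>x\<close> computed from the exact Riemannian gradient.\<close>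

definition stationarity_step ::
    "'a::euclidean_space set \<Rightarrow> ('a \<Rightarrow> real) \<Rightarrow> ('a \<Rightarrow> real) \<Rightarrow> real \<Rightarrow> 'a \<Rightarrow> 'a" where
  "stationarity_step M f h \<gamma> x = bregman_step h \<gamma> (orth_proj (tangent_space M x) (gradient f x)) x"

end

(* The nearest-point projection makes the residual z - P z normal to M at P z.  Testing the secant
   bound |n . (x - y)| <= M4 |n| |x - y|^2 for normals n at y against points of M shows that P is
   2-Lipschitz along the step, and that tangent and normal spaces at nearby points are orthogonal up
   to their distance.  Hence, for noise no larger than the gradient bound, one step decreases f by a
   multiple of the squared step; larger noise is absorbed by its own square.  The remaining noise term is linear with a coefficient depending only on the
   current iterate, so it vanishes in expectation, and summing over the iterations telescopes. *)

theory Submission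
  imports Defs
begin

text \<open>The step \<zeta> need not be tangent and the noise is unbounded, so the normal part of
  \<alpha> \<zeta> at x can have any size. Working instead with the residual n at the landing point
  y avoids splitting the step: n is no longer than \<alpha> \<zeta>, because x itself competes for
  the nearest point. The first-order error then consists of two pairings, the tangent part of the
  gradient at x with n, and the normal part of that gradient with y - x. Both are quadratic in the
  length of \<alpha> \<zeta>, and the cap on \<alpha> keeps them, together with the curvature term,
  below 7/8 of the guaranteed decrease. The cases are separated at noise of size \<open>Gf\<close>
  because only then is the step short enough for the cap to yield the smallness that the 2-Lipschitz
  estimate requires. The step depends on the noise, so the product of noise and step has no mean
  zero. Replacing the step by its noiseless version v costs only the square of the noise, since the
  step is a Lipschitz function of the vector it is computed from.\<close>

section \<open>Gradients and Hessians of C^1 and C^2 functions\<close>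

lemma gderiv_gradient:
  fixes f :: "'a::euclidean_space \<Rightarrow> real"
  assumes "f differentiable (at x)"
  shows "GDERIV f x :> gradient f x"
proof -
  obtain f' where f': "(f has_derivative f') (at x)"
    using assms by (auto simp: differentiable_def)
  \<comment> \<open>The Riesz representative of the derivative; the \<open>THE\<close> in
    \<open>gradient\<close> needs both its existence and its uniqueness.\<close>
  define g where "g = (\<Sum>i\<in>Basis. f' i *\<^sub>R i)"
  interpret bounded_linear f' using f' by (rule has_derivative_bounded_linear)
  have "f' v = v \<bullet> g" for v
  proof -
    have "f' v = f' (\<Sum>i\<in>Basis. (v \<bullet> i) *\<^sub>R i)" by (simp add: euclidean_representation)
    also have "\<dots> = (\<Sum>i\<in>Basis. (v \<bullet> i) * f' i)" by (simp add: sum scaleR)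
    also have "\<dots> = v \<bullet> g" by (simp add: g_def inner_sum_right mult.commute)
    finally show ?thesis .
  qed
  then have "f' = (\<lambda>v. v \<bullet> g)" by auto
  then have G: "GDERIV f x :> g" using f' by (simp add: gderiv_def)
  have "g' = g" if "GDERIV f x :> g'" for g'
  proof -
    have "(\<lambda>v. v \<bullet> g') = (\<lambda>v. v \<bullet> g)"
      using G that unfolding gderiv_def by (metis has_derivative_unique)
    then show ?thesis by (metis inner_commute vector_eq_rdot)
  qed
  then show ?thesis unfolding gradient_def using G by (metis theI')
qed

lemma has_derivative_gradient:
  fixes f :: "'a::euclidean_space \<Rightarrow> real"
  assumes "f differentiable (at x)"
  shows "(f has_derivative (\<lambda>v. gradient f x \<bullet> v)) (at x)"
  using gderiv_gradient[OF assms] by (simp add: gderiv_def inner_commute)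

lemma gradient_inner:
  fixes f :: "'a::euclidean_space \<Rightarrow> real"
  assumes "f differentiable (at x)"
  shows "gradient f x \<bullet> v = frechet_derivative f (at x) v"
  using frechet_derivative_at[OF has_derivative_gradient[OF assms]] by metis

lemma gradient_eq_sum:
  fixes f :: "'a::euclidean_space \<Rightarrow> real"
  assumes "f differentiable (at x)"
  shows "gradient f x = (\<Sum>i\<in>Basis. frechet_derivative f (at x) i *\<^sub>R i)"
  using gradient_inner[OF assms] euclidean_representation[of "gradient f x"] by (metis (no_types, lifting) sum.cong)

lemma Ck_on_1_gradient:
  fixes f :: "'a::euclidean_space \<Rightarrow> real"
  assumes "Ck_on 1 UNIV f"
  shows "f differentiable (at x)" "continuous_on UNIV (gradient f)"
proof -
  show d: "f differentiable (at x)" for x using assms by simp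
  have "gradient f = (\<lambda>x. \<Sum>i\<in>Basis. frechet_derivative f (at x) i *\<^sub>R i)"
    using gradient_eq_sum[OF d] by auto
  then show "continuous_on UNIV (gradient f)"
    using assms by (auto intro!: continuous_intros)
qed

lemma Ck_on_2_gradient:
  fixes h :: "'a::euclidean_space \<Rightarrow> real"
  assumes "Ck_on 2 UNIV h"
  shows "h differentiable (at x)"
    and "(gradient h has_derivative hessian h x) (at x)"
    and "continuous_on UNIV (\<lambda>x. hessian h x v)"
proof -
  have C: "Ck_on (Suc (Suc 0)) UNIV h" using assms by (simp add: numeral_2_eq_2)
  show d: "h differentiable (at x)" for x using C by simp
  have eq: "gradient h = (\<lambda>x. \<Sum>i\<in>Basis. frechet_derivative h (at x) i *\<^sub>R i)"
    using gradient_eq_sum[OF d] by auto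
  have d2: "(\<lambda>x. frechet_derivative h (at x) i) differentiable (at x)" for i x
    using C by simp
  have D2: "((\<lambda>x. frechet_derivative h (at x) i) has_derivative
      frechet_derivative (\<lambda>x. frechet_derivative h (at x) i) (at x)) (at x)" for i x
    using d2 frechet_derivative_works by blast
  have G: "(gradient h has_derivative
      (\<lambda>v. \<Sum>i\<in>Basis. frechet_derivative (\<lambda>x. frechet_derivative h (at x) i) (at x) v *\<^sub>R i)) (at x)" for x
    unfolding eq by (auto intro!: derivative_eq_intros D2)
  have H: "hessian h x = (\<lambda>v. \<Sum>i\<in>Basis. frechet_derivative (\<lambda>x. frechet_derivative h (at x) i) (at x) v *\<^sub>R i)" for x
    unfolding hessian_def using frechet_derivative_at[OF G] by simp
  show "(gradient h has_derivative hessian h x) (at x)" using G H by simp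
  show "continuous_on UNIV (\<lambda>x. hessian h x v)"
    unfolding H using C by (auto intro!: continuous_intros)
qed

text \<open>Continuity is available for each \<open>hessian h x v\<close> with v fixed, not directly
  for the operator norm; the sum of the column norms is continuous and dominates it.\<close>

lemma bdd_above_onorm_hessian:
  fixes h :: "'a::euclidean_space \<Rightarrow> real"
  assumes h: "Ck_on 2 UNIV h" and S: "compact S"
  shows "bdd_above ((\<lambda>x. onorm (hessian h x)) ` S)"
proof -
  have le: "onorm (hessian h x) \<le> (\<Sum>i\<in>Basis. norm (hessian h x i))" for x
    using Ck_on_2_gradient(2)[OF h, of x] by (auto intro!: onorm_componentwise has_derivative_bounded_linear)
  have c: "continuous_on S (\<lambda>x. \<Sum>i\<in>Basis. norm (hessian h x i))"
    by (intro continuous_intros continuous_on_subset[OF Ck_on_2_gradient(3)[OF h]]) auto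
  then obtain B where "\<And>x. x \<in> S \<Longrightarrow> norm (\<Sum>i\<in>Basis. norm (hessian h x i)) \<le> B"
    using compact_imp_bounded[OF compact_continuous_image[OF c S]] by (auto simp: bounded_iff)
  then show ?thesis
    by (intro bdd_aboveI[where M=B]) (use le in \<open>fastforce intro: order_trans\<close>)
qed

lemma onorm_hessian_le_max:
  fixes h :: "'a::euclidean_space \<Rightarrow> real"
  assumes "Ck_on 2 UNIV h" "compact M" "x \<in> M"
  shows "onorm (hessian h x) \<le> max_hess_norm M h"
  unfolding max_hess_norm_def using bdd_above_onorm_hessian[OF assms(1,2)] assms(3)
  by (intro cSUP_upper) auto

lemma gradient_le_max_grad_norm:
  fixes f :: "'a::euclidean_space \<Rightarrow> real"
  assumes "continuous_on UNIV (gradient f)" "compact M" "x \<in> M"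
  shows "norm (gradient f x) \<le> max_grad_norm M f"
  unfolding max_grad_norm_def
proof (intro cSUP_upper[OF assms(3)] bounded_imp_bdd_above compact_imp_bounded)
  show "compact ((\<lambda>x. norm (gradient f x)) ` M)"
    using assms by (intro compact_continuous_image continuous_intros continuous_on_subset[OF assms(1)]) auto
qed

section \<open>Quadratic upper bounds for the Bregman distance\<close>

text \<open>The convex hull of S is compact and contains all segments, so the mean value inequality
  applies twice, to the gradient and then to h minus its linear part. The constant is unrelated to
  \<open>max_hess_norm\<close>; it serves where the step-size cap gives no control, namely for large
  noise.\<close>

lemma bregman_quadratic_bound_on_compact:
  fixes h :: "'a::euclidean_space \<Rightarrow> real"
  assumes h: "Ck_on 2 UNIV h" and S: "compact S"
  obtains K where "K \<ge> 0"
    and "\<And>x y. x \<in> S \<Longrightarrow> y \<in> S \<Longrightarrow> bregman h y x \<le> K * (norm (y - x))\<^sup>2"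
proof -
  let ?H = "convex hull S"
  have cH: "compact ?H" "convex ?H" using S by (auto simp: compact_convex_hull)
  obtain K0 where K0: "\<And>x. x \<in> ?H \<Longrightarrow> onorm (hessian h x) \<le> K0"
    using bdd_above_onorm_hessian[OF h cH(1)] by (auto simp: bdd_above_def)
  define K where "K = max K0 0"
  have K: "K \<ge> 0" "\<And>x. x \<in> ?H \<Longrightarrow> onorm (hessian h x) \<le> K"
    using K0 by (auto simp: K_def max_def dest: order_trans)
  have lip: "norm (gradient h y - gradient h x) \<le> K * norm (y - x)" if "x \<in> ?H" "y \<in> ?H" for x y
    by (rule differentiable_bound[OF cH(2) _ K(2) that(2,1)])
       (rule has_derivative_at_withinI[OF Ck_on_2_gradient(2)[OF h]])
  have breg: "bregman h y x \<le> K * (norm (y - x))\<^sup>2" if xy: "x \<in> ?H" "y \<in> ?H" for x y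
  proof -
    have "norm ((h y - gradient h x \<bullet> y) - (h x - gradient h x \<bullet> x)) \<le> (K * norm (y - x)) * norm (y - x)"
    proof (rule differentiable_bound[where S = "closed_segment x y" and
          f' = "\<lambda>u v. gradient h u \<bullet> v - gradient h x \<bullet> v" and f = "\<lambda>u. h u - gradient h x \<bullet> u"])
      fix u assume u: "u \<in> closed_segment x y"
      show "((\<lambda>u. h u - gradient h x \<bullet> u) has_derivative (\<lambda>v. gradient h u \<bullet> v - gradient h x \<bullet> v)) (at u within closed_segment x y)"
        by (rule has_derivative_at_withinI)
          (auto intro!: derivative_eq_intros has_derivative_gradient Ck_on_2_gradient(1)[OF h])
      have uH: "u \<in> ?H" using u xy by (meson cH(2) closed_segment_subset subsetD)
      have "norm (gradient h u - gradient h x) \<le> K * norm (u - x)" by (rule lip[OF xy(1) uH])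
      also have "\<dots> \<le> K * norm (y - x)"
        using u K(1) by (intro mult_left_mono) (auto simp: norm_minus_commute dest: segment_bound1)
      finally have *: "norm (gradient h u - gradient h x) \<le> K * norm (y - x)" .
      show "onorm (\<lambda>v. gradient h u \<bullet> v - gradient h x \<bullet> v) \<le> K * norm (y - x)"
      proof (rule onorm_le)
        fix v
        have "norm (gradient h u \<bullet> v - gradient h x \<bullet> v) \<le> norm (gradient h u - gradient h x) * norm v"
          by (metis Cauchy_Schwarz_ineq2 inner_diff_left real_norm_def)
        then show "norm (gradient h u \<bullet> v - gradient h x \<bullet> v) \<le> K * norm (y - x) * norm v"
          using * by (meson mult_right_mono norm_ge_zero order_trans)
      qed
    qed auto
    then show ?thesis
      by (auto simp: bregman_def inner_diff_right power2_eq_square)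
  qed
  show thesis using that[OF K(1)] breg hull_inc by metis
qed

text \<open>A mean value inequality for maps that need not be differentiable. Each point r has a
  neighbourhood with slope at most C + e relative to r; an interval around r is split at r, and
  \<open>Bolzano\<close> glues the pieces. Then e tends to 0.\<close>

lemma lipschitz_from_local:
  fixes g :: "real \<Rightarrow> 'b::real_normed_vector"
  assumes ab: "a \<le> b"
    and loc: "\<And>r e. r \<in> {a..b} \<Longrightarrow> e > 0 \<Longrightarrow>
      \<exists>d>0. \<forall>s\<in>{a..b}. \<bar>s - r\<bar> < d \<longrightarrow> norm (g s - g r) \<le> (C + e) * \<bar>s - r\<bar>"
  shows "norm (g b - g a) \<le> C * (b - a)"
proof -
  have e: "norm (g b - g a) \<le> (C + e) * (b - a)" if "e > 0" for e
  proof -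
    define Q where "Q u w \<longleftrightarrow> (a \<le> u \<and> w \<le> b \<longrightarrow> norm (g w - g u) \<le> (C + e) * (w - u))" for u w
    have "Q a b" using ab
    proof (induction rule: Bolzano)
      case (trans u v w)
      then show ?case unfolding Q_def
        using norm_triangle_ineq[of "g w - g v" "g v - g u"] by (auto simp: algebra_simps)
    next
      case (local r)
      then obtain d where d: "d > 0" "\<And>s. s \<in> {a..b} \<Longrightarrow> \<bar>s - r\<bar> < d \<Longrightarrow> norm (g s - g r) \<le> (C + e) * \<bar>s - r\<bar>"
        using loc[of r e] \<open>e > 0\<close> by auto
      show ?case
      proof (intro exI[of _ d] conjI allI impI d(1))
        fix u w assume uw: "u \<le> r \<and> r \<le> w \<and> w - u < d"
        show "Q u w" unfolding Q_def
        proof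
          assume "a \<le> u \<and> w \<le> b"
          then have "norm (g u - g r) \<le> (C + e) * \<bar>u - r\<bar>" "norm (g w - g r) \<le> (C + e) * \<bar>w - r\<bar>"
            using uw d(2)[of u] d(2)[of w] by auto
          then show "norm (g w - g u) \<le> (C + e) * (w - u)"
            using uw norm_triangle_ineq[of "g w - g r" "g r - g u"]
            by (simp add: norm_minus_commute algebra_simps abs_of_nonpos abs_of_nonneg)
        qed
      qed
    qed
    then show ?thesis by (simp add: Q_def)
  qed
  show ?thesis
  proof (rule field_le_epsilon)
    fix e :: real assume "e > 0"
    show "norm (g b - g a) \<le> C * (b - a) + e"
    proof (cases "b = a")
      case False
      then have "norm (g b - g a) \<le> (C + e / (b - a)) * (b - a)" using ab \<open>e > 0\<close> by (intro e) auto
      then show ?thesis using False by (simp add: distrib_right)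
    qed (use \<open>e > 0\<close> in auto)
  qed
qed

text \<open>The path p is merely Lipschitz, so there is no chain rule. The derivative bound C of q
  and the Lipschitz constant l of p still multiply, up to an arbitrarily small e.\<close>

lemma has_derivative_along_lipschitz_path:
  fixes q :: "'a::real_normed_vector \<Rightarrow> 'b::real_normed_vector" and p :: "real \<Rightarrow> 'a"
  assumes D: "(q has_derivative q') (at (p r))" and r: "r \<in> {a..b}"
    and lip: "\<And>s. s \<in> {a..b} \<Longrightarrow> norm (p s - p r) \<le> l * \<bar>s - r\<bar>" and l: "l \<ge> 0"
    and C: "onorm q' \<le> C" and e: "e > 0"
  shows "\<exists>d>0. \<forall>s\<in>{a..b}. \<bar>s - r\<bar> < d \<longrightarrow> norm (q (p s) - q (p r)) \<le> (C * l + e) * \<bar>s - r\<bar>"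
proof -
  \<comment> \<open>The summand 1 covers the case l = 0.\<close>
  define e' where "e' = e / (l + 1)"
  have e': "e' > 0" "e' * l \<le> e" using e l by (auto simp: e'_def field_simps)
  obtain d where d: "d > 0" "\<And>y. norm (y - p r) < d \<Longrightarrow> norm (q y - q (p r) - q' (y - p r)) \<le> e' * norm (y - p r)"
    using D e'(1) unfolding has_derivative_at_alt by metis
  have bl: "bounded_linear q'" using D by (rule has_derivative_bounded_linear)
  show ?thesis
  proof (intro exI[of _ "d / (l + 1)"] conjI ballI impI)
    show "d / (l + 1) > 0" using d l by simp
    fix s assume s: "s \<in> {a..b}" "\<bar>s - r\<bar> < d / (l + 1)"
    have lt: "norm (p s - p r) \<le> l * \<bar>s - r\<bar>" by (rule lip[OF s(1)])
    also have "\<dots> \<le> l * (d / (l + 1))" using s l by (intro mult_left_mono) auto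
    also have "\<dots> < d" using d l by (simp add: field_simps)
    finally have "norm (q (p s) - q (p r) - q' (p s - p r)) \<le> e' * norm (p s - p r)" by (rule d(2))
    moreover have "norm (q' (p s - p r)) \<le> C * norm (p s - p r)"
      using onorm[OF bl] C by (meson mult_right_mono norm_ge_zero order_trans)
    ultimately have "norm (q (p s) - q (p r)) \<le> (C + e') * norm (p s - p r)"
      using norm_triangle_ineq[of "q (p s) - q (p r) - q' (p s - p r)" "q' (p s - p r)"]
      by (simp add: algebra_simps)
    also have "\<dots> \<le> (C + e') * (l * \<bar>s - r\<bar>)"
      using lt e' C onorm_pos_le[OF bl] by (intro mult_left_mono) auto
    also have "\<dots> = (C * l + e' * l) * \<bar>s - r\<bar>" by (simp add: algebra_simps)
    also have "\<dots> \<le> (C * l + e) * \<bar>s - r\<bar>" using e'(2) by (intro mult_right_mono) auto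
    finally show "norm (q (p s) - q (p r)) \<le> (C * l + e) * \<bar>s - r\<bar>" .
  qed
qed

text \<open>The Hessian bound is only available on \<open>M\<close>, which need not contain the segment from \<open>x\<close>
  to \<open>y\<close>; the second-order estimate is therefore made along a Lipschitz path in \<open>M\<close>.\<close>

lemma bregman_le_along_lipschitz_path:
  fixes h :: "'a::euclidean_space \<Rightarrow> real"
  assumes h: "Ck_on 2 UNIV h"
    and H: "\<And>x. x \<in> M \<Longrightarrow> onorm (hessian h x) \<le> H"
    and p: "p ` {0..1} \<subseteq> M" and l: "l \<ge> 0"
    and lip: "\<And>r s. r \<in> {0..1} \<Longrightarrow> s \<in> {0..1} \<Longrightarrow> norm (p s - p r) \<le> l * \<bar>s - r\<bar>"
  shows "bregman h (p 1) (p 0) \<le> H * l\<^sup>2"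
proof -
  have pM: "p r \<in> M" if "r \<in> {0..1}" for r using p that by auto
  have H0: "H \<ge> 0" using H[OF pM[of 0]] onorm_pos_le[OF has_derivative_bounded_linear[OF Ck_on_2_gradient(2)[OF h]]]
    by (auto intro: order_trans)
  have G: "norm (gradient h (p r) - gradient h (p 0)) \<le> H * l" if r: "r \<in> {0..1}" for r
  proof -
    have "norm (gradient h (p r) - gradient h (p 0)) \<le> (H * l) * (r - 0)"
    proof (rule lipschitz_from_local[of 0 r "\<lambda>s. gradient h (p s)"])
      show "0 \<le> r" using r by simp
      fix u e :: real assume u: "u \<in> {0..r}" "e > 0"
      show "\<exists>d>0. \<forall>s\<in>{0..r}. \<bar>s - u\<bar> < d \<longrightarrow> norm (gradient h (p s) - gradient h (p u)) \<le> (H * l + e) * \<bar>s - u\<bar>"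
        by (rule has_derivative_along_lipschitz_path[OF Ck_on_2_gradient(2)[OF h] u(1) _ l H u(2)])
           (use u r lip pM in auto)
    qed
    also have "\<dots> \<le> (H * l) * 1" using r H0 l by (intro mult_left_mono) auto
    finally show ?thesis by simp
  qed
  \<comment> \<open>Subtracting the linear part leaves a function whose gradient on the path is at
    most H * l by \<open>G\<close>; running the same argument on it contributes the second factor
    l.\<close>
  define q where "q u = h u - gradient h (p 0) \<bullet> u" for u
  have q: "(q has_derivative (\<lambda>v. (gradient h u - gradient h (p 0)) \<bullet> v)) (at u)" for u
    unfolding q_def
    by (auto intro!: derivative_eq_intros has_derivative_gradient Ck_on_2_gradient(1)[OF h] simp: inner_diff_left)
  have "norm (q (p 1) - q (p 0)) \<le> (H * l * l) * (1 - 0)"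
  proof (rule lipschitz_from_local[of 0 1 "\<lambda>s. q (p s)"])
    fix u e :: real assume u: "u \<in> {0..1}" "e > 0"
    have "onorm (\<lambda>v. (gradient h (p u) - gradient h (p 0)) \<bullet> v) \<le> H * l"
    proof (rule onorm_le)
      fix v
      show "norm ((gradient h (p u) - gradient h (p 0)) \<bullet> v) \<le> H * l * norm v"
        using Cauchy_Schwarz_ineq2[of "gradient h (p u) - gradient h (p 0)" v] G[OF u(1)]
        by (smt (verit) mult_right_mono norm_ge_zero real_norm_def)
    qed
    then show "\<exists>d>0. \<forall>s\<in>{0..1}. \<bar>s - u\<bar> < d \<longrightarrow> norm (q (p s) - q (p u)) \<le> (H * l * l + e) * \<bar>s - u\<bar>"
      using u by (intro has_derivative_along_lipschitz_path[OF q u(1) _ l _ u(2)] lip) auto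
  qed auto
  then show ?thesis by (auto simp: q_def bregman_def inner_diff_right power2_eq_square algebra_simps)
qed

section \<open>Orthogonal projections onto subspaces\<close>

lemma orth_proj_props:
  fixes S :: "'a::euclidean_space set"
  assumes "subspace S"
  shows orth_proj_in: "orth_proj S w \<in> S"
    and orth_proj_residual: "w - orth_proj S w \<in> orthogonal_comp S"
    and orth_proj_unique: "p \<in> S \<Longrightarrow> w - p \<in> orthogonal_comp S \<Longrightarrow> orth_proj S w = p"
proof -
  obtain y z where yz: "y \<in> span S" "\<And>v. v \<in> span S \<Longrightarrow> orthogonal z v" "w = y + z"
    using orthogonal_subspace_decomp_exists by blast
  have sp: "span S = S" using assms by (simp add: span_eq_iff)
  have y: "y \<in> S" "w - y \<in> orthogonal_comp S"
    using yz sp by (auto simp: orthogonal_comp_def orthogonal_commute)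
  have uniq: "p = q" if p: "p \<in> S" "w - p \<in> orthogonal_comp S" and q: "q \<in> S" "w - q \<in> orthogonal_comp S" for p q
  proof -
    have "p - q \<in> S" using assms p(1) q(1) by (rule subspace_diff)
    then have "(p - q) \<bullet> (w - q) = 0" "(p - q) \<bullet> (w - p) = 0"
      using p(2) q(2) by (auto simp: orthogonal_comp_def orthogonal_def)
    then have "(p - q) \<bullet> (p - q) = 0" by (simp add: inner_diff_right)
    then show ?thesis by simp
  qed
  have "orth_proj S w = y" unfolding orth_proj_def
    by (rule the_equality) (use y uniq in blast)+
  then show "orth_proj S w \<in> S" "w - orth_proj S w \<in> orthogonal_comp S"
    "p \<in> S \<Longrightarrow> w - p \<in> orthogonal_comp S \<Longrightarrow> orth_proj S w = p"
    using y uniq by auto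
qed

lemma inner_orth_proj_residual:
  assumes "subspace S" "v \<in> S"
  shows "v \<bullet> (w - orth_proj S w) = 0"
  using orth_proj_residual[OF assms(1), of w] assms(2) by (auto simp: orthogonal_comp_def orthogonal_def)

lemma inner_orth_proj:
  assumes "subspace S" "v \<in> S"
  shows "v \<bullet> orth_proj S w = v \<bullet> w"
  using inner_orth_proj_residual[OF assms, of w] by (simp add: inner_diff_right)

lemma norm_orth_proj_le:
  assumes "subspace S"
  shows "norm (orth_proj S w) \<le> norm w"
proof -
  have "(norm (orth_proj S w))\<^sup>2 = orth_proj S w \<bullet> w"
    using inner_orth_proj[OF assms orth_proj_in[OF assms], of w w] by (simp add: dot_square_norm)
  also have "\<dots> \<le> norm (orth_proj S w) * norm w" by (rule norm_cauchy_schwarz)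
  finally show ?thesis
    by (metis mult_le_cancel_left norm_ge_zero not_less power2_eq_square order_le_less)
qed

lemma orth_proj_add:
  assumes "subspace S"
  shows "orth_proj S (u + w) = orth_proj S u + orth_proj S w"
proof (rule orth_proj_unique[OF assms])
  show "orth_proj S u + orth_proj S w \<in> S"
    using assms orth_proj_in subspace_add by blast
  have "(u - orth_proj S u) + (w - orth_proj S w) \<in> orthogonal_comp S"
    using assms orth_proj_residual subspace_add subspace_orthogonal_comp by blast
  then show "u + w - (orth_proj S u + orth_proj S w) \<in> orthogonal_comp S" by (simp add: algebra_simps)
qed

lemma orth_proj_scaleR:
  assumes "subspace S"
  shows "orth_proj S (c *\<^sub>R w) = c *\<^sub>R orth_proj S w"
proof (rule orth_proj_unique[OF assms])
  show "c *\<^sub>R orth_proj S w \<in> S"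
    using assms orth_proj_in subspace_scale by blast
  have "c *\<^sub>R (w - orth_proj S w) \<in> orthogonal_comp S"
    using assms orth_proj_residual subspace_scale subspace_orthogonal_comp by blast
  then show "c *\<^sub>R w - c *\<^sub>R orth_proj S w \<in> orthogonal_comp S" by (simp add: algebra_simps)
qed

lemma linear_orth_proj: "subspace S \<Longrightarrow> linear (orth_proj S)"
  by (simp add: linearI orth_proj_add orth_proj_scaleR)

lemma orth_proj_comp:
  assumes "subspace S"
  shows "orth_proj (orthogonal_comp S) w = w - orth_proj S w"
proof (rule orth_proj_unique[OF subspace_orthogonal_comp])
  show "w - orth_proj S w \<in> orthogonal_comp S" by (rule orth_proj_residual[OF assms])
  show "w - (w - orth_proj S w) \<in> orthogonal_comp (orthogonal_comp S)"
    using orth_proj_in[OF assms] orthogonal_comp_subset by auto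
qed

section \<open>Tangent and normal spaces of a submanifold\<close>

lemma Ck_on_cong:
  assumes "open S" "\<And>x. x \<in> S \<Longrightarrow> f x = g x" "Ck_on k S f"
  shows "Ck_on k S g"
  using assms(2,3)
proof (induction k arbitrary: f g)
  case 0
  then show ?case by (metis Ck_on.simps(1) continuous_on_cong)
next
  case (Suc k)
  have "g differentiable (at x) \<and> frechet_derivative f (at x) = frechet_derivative g (at x)" if x: "x \<in> S" for x
  proof -
    have "(f has_derivative frechet_derivative f (at x)) (at x)"
      using Suc.prems(2) x by (simp add: frechet_derivative_works)
    then have "(g has_derivative frechet_derivative f (at x)) (at x)"
      by (rule has_derivative_transform_within_open[OF _ assms(1) x Suc.prems(1)])
    then show ?thesis using frechet_derivative_at differentiable_def by blast
  qed
  moreover have "Ck_on k S (\<lambda>x. frechet_derivative g (at x) v)" for v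
    by (rule Suc.IH[of "\<lambda>x. frechet_derivative f (at x) v"]) (use calculation Suc.prems(2) in auto)
  ultimately show ?case by simp
qed

text \<open>The derivative of \<psi> along the line is a directional derivative of \<psi> along the
  same line, so the induction must be general in \<psi>.\<close>

lemma Ck_on_line:
  fixes \<psi> :: "'a::real_normed_vector \<Rightarrow> 'b::real_normed_vector"
  assumes "open I" "Ck_on k V \<psi>" "\<And>t. t \<in> I \<Longrightarrow> q + t *\<^sub>R w \<in> V"
  shows "Ck_on k I (\<lambda>t::real. \<psi> (q + t *\<^sub>R w))"
  using assms(2)
proof (induction k arbitrary: \<psi>)
  case 0
  then show ?case using assms(3)
    by (auto intro!: continuous_on_compose2[where f="\<lambda>t. q + t *\<^sub>R w"] continuous_intros)
next
  case (Suc k)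
  have D: "((\<lambda>t. \<psi> (q + t *\<^sub>R w)) has_derivative (\<lambda>s. frechet_derivative \<psi> (at (q + t *\<^sub>R w)) (s *\<^sub>R w))) (at t)"
    if "t \<in> I" for t
  proof (rule has_derivative_compose[where f="\<lambda>t. q + t *\<^sub>R w"])
    show "((\<lambda>t. q + t *\<^sub>R w) has_derivative (\<lambda>s. s *\<^sub>R w)) (at t)"
      by (auto intro!: derivative_eq_intros)
    show "(\<psi> has_derivative frechet_derivative \<psi> (at (q + t *\<^sub>R w))) (at (q + t *\<^sub>R w))"
      using Suc.prems assms(3)[OF that] by (simp add: frechet_derivative_works)
  qed
  show ?case unfolding Ck_on.simps
  proof (intro conjI ballI allI)
    fix t assume "t \<in> I"
    then show "(\<lambda>t. \<psi> (q + t *\<^sub>R w)) differentiable at t"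
      using D differentiable_def by blast
  next
    fix s :: real
    have "Ck_on k I (\<lambda>t. frechet_derivative \<psi> (at (q + t *\<^sub>R w)) (s *\<^sub>R w))"
      by (rule Suc.IH[of "\<lambda>x. frechet_derivative \<psi> (at x) (s *\<^sub>R w)"]) (use Suc.prems in simp)
    then show "Ck_on k I (\<lambda>x. frechet_derivative (\<lambda>t. \<psi> (q + t *\<^sub>R w)) (at x) s)"
      by (rule Ck_on_cong[OF assms(1), rotated]) (use D frechet_derivative_at in metis)
  qed
qed

text \<open>Velocities of curves do not visibly form a subspace; a chart exhibits them as a linear
  image of W. Curves in M are flattened into W by \<phi>, and straight lines in W are carried back
  to curves in M by \<psi>.\<close>

lemma tangent_space_chart:
  fixes M W :: "'a::euclidean_space set"
  assumes x: "x \<in> M" and U: "open U" "x \<in> U" and V: "open V" and hom: "homeomorphism U V \<phi> \<psi>"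
    and sm: "smooth_on U \<phi>" "smooth_on V \<psi>" and W: "subspace W" and im: "\<phi> ` (U \<inter> M) = V \<inter> W"
  shows "tangent_space M x = frechet_derivative \<psi> (at (\<phi> x)) ` W"
proof -
  define q where "q = \<phi> x"
  have qV: "q \<in> V" and qW: "q \<in> W" using im x U by (auto simp: q_def)
  have \<psi>q: "\<psi> q = x" using hom U by (simp add: q_def homeomorphism_def)
  have dphi: "\<phi> differentiable (at x)" and dpsi: "\<psi> differentiable (at q)"
    using sm U qV unfolding smooth_on_def by (metis Ck_on.simps(2))+
  let ?A = "frechet_derivative \<phi> (at x)" and ?B = "frechet_derivative \<psi> (at q)"
  have A: "(\<phi> has_derivative ?A) (at x)" and B: "(\<psi> has_derivative ?B) (at q)"
    using dphi dpsi by (simp_all add: frechet_derivative_works)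
  \<comment> \<open>Near x the composition of \<phi> and \<psi> is the identity, so the chain rule
    makes \<open>?B\<close> a left inverse of \<open>?A\<close>.\<close>
  have BA: "?B (?A v) = v" for v
  proof -
    have "((\<lambda>y. \<psi> (\<phi> y)) has_derivative (\<lambda>v. ?B (?A v))) (at x)"
      using has_derivative_compose[OF A] B q_def by blast
    then have "((\<lambda>y. y) has_derivative (\<lambda>v. ?B (?A v))) (at x)"
      by (rule has_derivative_transform_within_open[OF _ U]) (use hom in \<open>simp add: homeomorphism_def\<close>)
    then have "(\<lambda>v. ?B (?A v)) = (\<lambda>v. v)"
      by (metis has_derivative_ident has_derivative_unique)
    then show ?thesis by metis
  qed
  show ?thesis unfolding q_def[symmetric]
  proof (intro equalityI subsetI)
    fix v assume "v \<in> tangent_space M x"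
    then obtain c e where c: "e > 0" "c ` {-e<..<e} \<subseteq> M" "c 0 = x"
        "(c has_vector_derivative v) (at (0::real))"
      unfolding tangent_space_def by blast
    have "((\<lambda>t. \<phi> (c t)) has_derivative (\<lambda>t. ?A (t *\<^sub>R v))) (at 0)"
      by (rule has_derivative_compose[OF c(4)[unfolded has_vector_derivative_def]]) (unfold c(3), rule A)
    then have "((\<lambda>t. \<phi> (c t)) has_vector_derivative ?A v) (at 0)"
      using linear_frechet_derivative[OF dphi] by (simp add: has_vector_derivative_def linear_cmul)
    then have lim0: "((\<lambda>t. norm (\<phi> (c t) - q - t *\<^sub>R ?A v) / norm t) \<longlongrightarrow> 0) (at 0)"
      using c(3) unfolding has_vector_derivative_def has_derivative_at by (simp add: q_def)
    \<comment> \<open>The velocity of the flattened curve is a limit of difference quotients that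
      eventually lie in W; W is closed, so the limit lies there too.\<close>
    have lim: "((\<lambda>t. (1 / t) *\<^sub>R (\<phi> (c t) - q)) \<longlongrightarrow> ?A v) (at 0)"
    proof (subst Lim_null, rule tendsto_norm_zero_cancel, rule Lim_transform_eventually[OF lim0])
      have "norm (\<phi> (c t) - q - t *\<^sub>R ?A v) / norm t = norm ((1 / t) *\<^sub>R (\<phi> (c t) - q) - ?A v)" if "t \<noteq> 0" for t
      proof -
        have "(1 / t) *\<^sub>R (\<phi> (c t) - q) - ?A v = (1 / t) *\<^sub>R (\<phi> (c t) - q - t *\<^sub>R ?A v)"
          using that by (simp add: scaleR_diff_right)
        then show ?thesis by (simp add: divide_inverse)
      qed
      then show "\<forall>\<^sub>F t in at 0. norm (\<phi> (c t) - q - t *\<^sub>R ?A v) / norm t = norm ((1 / t) *\<^sub>R (\<phi> (c t) - q) - ?A v)"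
        by (auto simp: eventually_at_filter)
    qed
    have cont: "isCont c 0" using c(4) has_vector_derivative_continuous by blast
    have evU: "\<forall>\<^sub>F t in at 0. c t \<in> U"
      using topological_tendstoD[OF cont[unfolded isCont_def] U(1)] U c(3) by simp
    have ev: "\<forall>\<^sub>F t in at 0. t \<in> {-e<..<e}"
      using c(1) by (intro eventually_at_in_open') auto
    have "\<forall>\<^sub>F t in at 0. (1 / t) *\<^sub>R (\<phi> (c t) - q) \<in> W"
      using evU ev
    proof eventually_elim
      case (elim t)
      then have "\<phi> (c t) \<in> W" using im c(2) by blast
      then show ?case using qW W by (simp add: subspace_diff subspace_scale)
    qed
    then have "?A v \<in> W"
      by (rule Lim_in_closed_set[OF closed_subspace[OF W] _ _ lim]) simp
    then show "v \<in> ?B ` W" using BA by (metis imageI)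
  next
    fix v assume "v \<in> ?B ` W"
    then obtain w where w: "w \<in> W" "v = ?B w" by blast
    define c where "c t = \<psi> (q + t *\<^sub>R w)" for t :: real
    \<comment> \<open>Openness of V keeps the line through q inside the chart for small t; this
      provides the e of the curve.\<close>
    have "open ((\<lambda>t::real. q + t *\<^sub>R w) -` V)"
      by (intro open_vimage[OF V] continuous_intros)
    then have "\<forall>\<^sub>F t in nhds (0::real). t \<in> (\<lambda>t. q + t *\<^sub>R w) -` V"
      using qV by (intro eventually_nhds_in_open) auto
    then obtain e where e: "e > 0" "\<And>t. \<bar>t\<bar> < e \<Longrightarrow> q + t *\<^sub>R w \<in> V"
      by (auto simp: eventually_nhds_metric dist_real_def)
    have "smooth_on {-e<..<e} c" unfolding smooth_on_def c_def
      using sm(2) e by (intro allI Ck_on_line) (auto simp: smooth_on_def)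
    moreover have "c ` {-e<..<e} \<subseteq> M"
    proof
      fix y assume "y \<in> c ` {-e<..<e}"
      then obtain t where "t \<in> {-e<..<e}" and t: "y = c t" by blast
      then have "\<bar>t\<bar> < e" by auto
      then have "q + t *\<^sub>R w \<in> V \<inter> W" using e qW w W by (simp add: subspace_add subspace_scale)
      then obtain m where "m \<in> U \<inter> M" "\<phi> m = q + t *\<^sub>R w" using im by (metis imageE)
      then show "y \<in> M" using hom t by (auto simp: c_def homeomorphism_def)
    qed
    moreover have "(c has_vector_derivative v) (at 0)"
    proof -
      have "(c has_derivative (\<lambda>t. ?B (t *\<^sub>R w))) (at 0)" unfolding c_def
        by (rule has_derivative_compose[of "\<lambda>t. q + t *\<^sub>R w" "\<lambda>t. t *\<^sub>R w"])
          (auto intro!: derivative_eq_intros B)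
      then show ?thesis
        using linear_frechet_derivative[OF dpsi] w by (simp add: has_vector_derivative_def linear_cmul)
    qed
    ultimately show "v \<in> tangent_space M x"
      unfolding tangent_space_def using e(1) \<psi>q by (intro CollectI exI[of _ c] exI[of _ e]) (simp add: c_def)
  qed
qed

lemma subspace_tangent_space:
  fixes M :: "'a::euclidean_space set"
  assumes "embedded_submanifold d M" "x \<in> M"
  shows "subspace (tangent_space M x)"
proof -
  obtain U V \<phi> \<psi> and W :: "'a set" where
    c: "open U" "x \<in> U" "open V" "homeomorphism U V \<phi> \<psi>" "smooth_on U \<phi>" "smooth_on V \<psi>"
      "subspace W" "\<phi> ` (U \<inter> M) = V \<inter> W"
    using assms unfolding embedded_submanifold_def by meson
  have "\<phi> x \<in> V" using c assms(2) by blast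
  then have "\<psi> differentiable (at (\<phi> x))" using c(6) unfolding smooth_on_def by (metis Ck_on.simps(2))
  then show ?thesis
    using tangent_space_chart[OF assms(2) c] c(7) linear_frechet_derivative linear_subspace_image by metis
qed

text \<open>Along any curve in M through y the squared distance to z has a minimum at time 0, so its
  derivative there vanishes.\<close>

lemma nearest_residual_normal:
  fixes M :: "'a::euclidean_space set"
  assumes y: "y \<in> M" and near: "\<And>m. m \<in> M \<Longrightarrow> dist z y \<le> dist z m"
  shows "z - y \<in> normal_space M y"
  unfolding normal_space_def orthogonal_comp_def orthogonal_def
proof (intro CollectI ballI)
  fix v assume "v \<in> tangent_space M y"
  then obtain c e where c: "e > 0" "c ` {-e<..<e} \<subseteq> M" "c 0 = y"
      "(c has_vector_derivative v) (at (0::real))"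
    unfolding tangent_space_def by blast
  define q where "q t = (z - c t) \<bullet> (z - c t)" for t
  have "(q has_derivative (\<lambda>t. (z - y) \<bullet> (- (t *\<^sub>R v)) + (- (t *\<^sub>R v)) \<bullet> (z - y))) (at 0)"
    unfolding q_def using c(3,4) by (auto intro!: derivative_eq_intros simp: has_vector_derivative_def)
  then have D: "(q has_real_derivative (- 2 * (v \<bullet> (z - y)))) (at 0)"
    by (auto simp: has_field_derivative_def inner_commute fun_eq_iff algebra_simps elim!: has_derivative_eq_rhs)
  have "q 0 \<le> q t" if "\<bar>0 - t\<bar> < e" for t
    using near[of "c t"] c(2) that by (auto simp: q_def dist_norm norm_le c(3) image_subset_iff abs_less_iff)
  then have "- 2 * (v \<bullet> (z - y)) = 0"
    by (intro DERIV_local_min[OF D c(1)]) auto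
  then show "v \<bullet> (z - y) = 0" by simp
qed

section \<open>Strong convexity and the Bregman step\<close>

text \<open>The function that remains after subtracting the quadratic is convex, hence lies above
  its tangent on the line from x to y; the quadratic accounts for the left-hand side.\<close>

lemma strongly_convex_bregman_lower:
  fixes h :: "'a::euclidean_space \<Rightarrow> real"
  assumes sc: "strongly_convex lam h" and d: "h differentiable (at x)"
  shows "lam / 2 * (norm (y - x))\<^sup>2 \<le> bregman h y x"
proof -
  define \<phi> where "\<phi> z = h z - lam / 2 * (z \<bullet> z)" for z
  have conv: "convex_on UNIV \<phi>" using sc by (simp add: strongly_convex_def \<phi>_def[abs_def] power2_norm_eq_inner)
  define u where "u t = \<phi> (x + t *\<^sub>R (y - x))" for t :: real
  have "convex_on UNIV u"
  proof (rule convex_onI)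
    fix t a b :: real assume t: "0 < t" "t < 1"
    have "x + ((1 - t) * a + t * b) *\<^sub>R (y - x) = (1 - t) *\<^sub>R (x + a *\<^sub>R (y - x)) + t *\<^sub>R (x + b *\<^sub>R (y - x))"
      by (simp add: algebra_simps)
    then show "u ((1 - t) *\<^sub>R a + t *\<^sub>R b) \<le> (1 - t) * u a + t * u b"
      unfolding u_def using convex_onD[OF conv, of t "x + a *\<^sub>R (y - x)" "x + b *\<^sub>R (y - x)"] t by simp
  qed simp
  moreover have "(u has_real_derivative (gradient h x \<bullet> (y - x) - lam * (x \<bullet> (y - x)))) (at 0)"
  proof -
    have "((\<lambda>t. h (x + t *\<^sub>R (y - x))) has_derivative (\<lambda>t. gradient h x \<bullet> (t *\<^sub>R (y - x)))) (at 0)"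
    proof (rule has_derivative_compose[where f = "\<lambda>t. x + t *\<^sub>R (y - x)"])
      show "((\<lambda>t. x + t *\<^sub>R (y - x)) has_derivative (\<lambda>t. t *\<^sub>R (y - x))) (at 0)"
        by (auto intro!: derivative_eq_intros)
    qed (use has_derivative_gradient[OF d] in simp)
    then show ?thesis unfolding u_def \<phi>_def has_field_derivative_def
      by (auto intro!: derivative_eq_intros simp: fun_eq_iff inner_commute algebra_simps)
  qed
  ultimately have "u 1 - u 0 \<ge> (gradient h x \<bullet> (y - x) - lam * (x \<bullet> (y - x))) * (1 - 0)"
    by (intro convex_on_imp_above_tangent[of UNIV]) auto
  then show ?thesis
    by (simp add: u_def \<phi>_def bregman_def power2_norm_eq_inner inner_commute algebra_simps inner_diff_left inner_diff_right)
qed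

text \<open>The sum of the lower bounds for the two Bregman distances between x and y.\<close>

lemma strongly_convex_gradient_monotone:
  fixes h :: "'a::euclidean_space \<Rightarrow> real"
  assumes "strongly_convex lam h" and d: "\<And>x. h differentiable (at x)"
  shows "lam * (norm (y - x))\<^sup>2 \<le> (gradient h y - gradient h x) \<bullet> (y - x)"
  using strongly_convex_bregman_lower[OF assms(1) d, of x y]
    strongly_convex_bregman_lower[OF assms(1) d, of y x]
  by (simp add: bregman_def norm_minus_commute inner_diff_left inner_diff_right)

text \<open>The first-order condition at the minimiser. The work lies in existence: strong convexity
  makes the objective coercive, so a minimum over a ball is a global one.\<close>

lemma bregman_step_optimality:
  fixes h :: "'a::euclidean_space \<Rightarrow> real"
  assumes sc: "strongly_convex lam h" and lam: "lam > 0" and d: "\<And>x. h differentiable (at x)"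
    and \<gamma>: "\<gamma> > 0"
  shows "g + \<gamma> *\<^sub>R (gradient h (x + bregman_step h \<gamma> g x) - gradient h x) = 0"
proof -
  define q where "q \<zeta> = g \<bullet> \<zeta> + \<gamma> * bregman h (x + \<zeta>) x" for \<zeta>
  have D: "(q has_derivative (\<lambda>v. (g + \<gamma> *\<^sub>R (gradient h (x + \<zeta>) - gradient h x)) \<bullet> v)) (at \<zeta>)" for \<zeta>
  proof -
    have "((\<lambda>\<zeta>. h (x + \<zeta>)) has_derivative (\<lambda>v. gradient h (x + \<zeta>) \<bullet> v)) (at \<zeta>)"
      by (rule has_derivative_compose[where f = "\<lambda>\<zeta>. x + \<zeta>" and f' = "\<lambda>v. v"])
        (auto intro!: derivative_eq_intros has_derivative_gradient d)
    then show ?thesis unfolding q_def bregman_def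
      by (auto intro!: derivative_eq_intros simp: fun_eq_iff inner_add_left inner_diff_left algebra_simps)
  qed
  have cont: "continuous_on S q" for S
    using D by (meson continuous_at_imp_continuous_on has_derivative_continuous)
  \<comment> \<open>Beyond this radius the quadratic \<gamma> * lam / 2 * norm \<zeta> ^ 2 outweighs
    the linear term, which is at least - norm g * norm \<zeta>.\<close>
  define R where "R = 2 * norm g / (\<gamma> * lam)"
  have R0: "R \<ge> 0" using lam \<gamma> by (simp add: R_def)
  have far: "q 0 \<le> q \<zeta>" if "norm \<zeta> > R" for \<zeta>
  proof -
    have "\<gamma> * (lam / 2 * (norm \<zeta>)\<^sup>2) \<le> \<gamma> * bregman h (x + \<zeta>) x"
      using strongly_convex_bregman_lower[OF sc d, of "x + \<zeta>" x] \<gamma> by (intro mult_left_mono) auto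
    moreover have "- (norm g * norm \<zeta>) \<le> g \<bullet> \<zeta>" using Cauchy_Schwarz_ineq2[of g \<zeta>] by linarith
    moreover have "norm g * norm \<zeta> \<le> \<gamma> * (lam / 2 * (norm \<zeta>)\<^sup>2)"
    proof -
      have "norm g \<le> \<gamma> * lam / 2 * norm \<zeta>" using that lam \<gamma> by (simp add: R_def field_simps)
      from mult_right_mono[OF this, of "norm \<zeta>"] show ?thesis by (simp add: power2_eq_square mult.assoc)
    qed
    ultimately show ?thesis by (simp add: q_def bregman_def)
  qed
  obtain z where z: "z \<in> cball 0 R" "\<And>y. y \<in> cball 0 R \<Longrightarrow> q z \<le> q y"
    using continuous_attains_inf[OF compact_cball _ cont, of 0 R] R0 by (auto simp: not_less)
  have "q z \<le> q y" for y
  proof (cases "norm y > R")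
    case True
    then show ?thesis using far[of y] z(2)[of 0] R0 by auto
  qed (use z(2) in auto)
  then have "is_arg_min q (\<lambda>_. True) z" by (simp add: is_arg_min_def not_less)
  \<comment> \<open>\<open>arg_min\<close> is a Hilbert choice; it is a minimiser only because one
    has been exhibited.\<close>
  then have "is_arg_min q (\<lambda>_. True) (arg_min q (\<lambda>_. True))"
    unfolding arg_min_def by (rule someI)
  then have min: "q (bregman_step h \<gamma> g x) \<le> q y" for y
    by (simp add: is_arg_min_def not_less bregman_step_def q_def[abs_def])
  then have "(\<lambda>v. (g + \<gamma> *\<^sub>R (gradient h (x + bregman_step h \<gamma> g x) - gradient h x)) \<bullet> v) = (\<lambda>v. 0)"
    by (intro has_derivative_local_min[OF D]) auto
  then show ?thesis by (metis inner_eq_zero_iff)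
qed

locale strongly_convex_step =
  fixes h :: "'a::euclidean_space \<Rightarrow> real" and lam \<gamma> :: real
  assumes sc: "strongly_convex lam h" and lam_pos: "lam > 0"
    and h_diff: "\<And>x. h differentiable (at x)" and \<gamma>_pos: "\<gamma> > 0"
begin

abbreviation "step g x \<equiv> bregman_step h \<gamma> g x"

lemma gradient_step: "gradient h (x + step g x) = gradient h x - (1 / \<gamma>) *\<^sub>R g"
proof -
  have "(1 / \<gamma>) *\<^sub>R (g + \<gamma> *\<^sub>R (gradient h (x + step g x) - gradient h x)) = 0"
    by (simp only: bregman_step_optimality[OF sc lam_pos h_diff \<gamma>_pos] scaleR_zero_right)
  then have "(1 / \<gamma>) *\<^sub>R g + (gradient h (x + step g x) - gradient h x) = 0"
    using \<gamma>_pos by (simp add: scaleR_add_right)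
  then show ?thesis by (simp add: algebra_simps eq_neg_iff_add_eq_0)
qed

lemma gradient_expansive: "lam * norm (y - x) \<le> norm (gradient h y - gradient h x)"
proof (cases "y = x")
  case False
  have "lam * (norm (y - x))\<^sup>2 \<le> norm (gradient h y - gradient h x) * norm (y - x)"
    using strongly_convex_gradient_monotone[OF sc h_diff, of y x]
      norm_cauchy_schwarz[of "gradient h y - gradient h x" "y - x"] by linarith
  then show ?thesis using False by (simp add: power2_eq_square)
qed simp

text \<open>By the optimality condition the gradient of h changes by - g / \<gamma> over the step;
  strong monotonicity compares this change with the step.\<close>

lemma step_descent: "g \<bullet> step g x \<le> - \<gamma> * lam * (norm (step g x))\<^sup>2"
proof -
  have "lam * (norm (step g x))\<^sup>2 \<le> (- (1 / \<gamma>) *\<^sub>R g) \<bullet> step g x"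
    using strongly_convex_gradient_monotone[OF sc h_diff, of "x + step g x" x] gradient_step[of x g] by simp
  then show ?thesis using \<gamma>_pos by (simp add: field_simps)
qed

text \<open>Changing g moves the gradient of h at the end point by (g - g') / \<gamma>, and by
  expansiveness the end point moves at most 1 / lam times as far.\<close>

lemma step_lipschitz: "norm (step g x - step g' x) \<le> norm (g - g') / (\<gamma> * lam)"
proof -
  have "lam * norm (step g x - step g' x) \<le> norm ((1 / \<gamma>) *\<^sub>R (g - g'))"
    using gradient_expansive[of "x + step g x" "x + step g' x"] gradient_step[of x g] gradient_step[of x g']
    by (simp add: scaleR_diff_right norm_minus_commute)
  also have "\<dots> = norm (g - g') / \<gamma>" using \<gamma>_pos by simp
  finally show ?thesis using \<gamma>_pos lam_pos by (simp add: field_simps)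
qed

lemma step_zero: "step 0 x = 0"
  using step_descent[of 0 x] \<gamma>_pos lam_pos by (simp add: mult_le_0_iff power2_eq_square)

lemma norm_step_le: "norm (step g x) \<le> norm g / (\<gamma> * lam)"
  using step_lipschitz[of g x 0] by (simp add: step_zero)

text \<open>The optimality condition solves for the step through the inverse k of the gradient of h,
  which is (1 / lam)-Lipschitz. This joint continuity later makes the steps measurable.\<close>

lemma continuous_step:
  assumes cont: "continuous_on UNIV (gradient h)"
  shows "continuous_on UNIV (\<lambda>(g, x). step g x)"
proof -
  define k where "k = inv (gradient h)"
  have inj: "inj (gradient h)"
    using gradient_expansive lam_pos by (intro injI) (metis diff_self mult_le_0_iff norm_le_zero_iff norm_zero not_less right_minus_eq)
  \<comment> \<open>A prescribed gradient y is reached by the step from 0 whose linear term is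
    \<gamma> times the missing difference.\<close>
  have surj: "surj (gradient h)"
  proof
    have "y = gradient h (0 + step (\<gamma> *\<^sub>R (gradient h 0 - y)) 0)" for y
      using \<gamma>_pos gradient_step[of 0 "\<gamma> *\<^sub>R (gradient h 0 - y)"] by simp
    then show "UNIV \<subseteq> range (gradient h)" by blast
  qed simp
  have k: "gradient h (k y) = y" "k (gradient h x) = x" for x y
    unfolding k_def using inj surj by (simp_all add: surj_f_inv_f)
  have "norm (k y - k z) \<le> (1 / lam) * norm (y - z)" for y z
    using gradient_expansive[of "k y" "k z"] lam_pos by (simp add: k field_simps)
  then have "(1 / lam)-lipschitz_on UNIV k"
    using lam_pos by (intro lipschitz_onI) (auto simp: dist_norm)
  then have "continuous_on UNIV k" by (rule lipschitz_on_continuous_on)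
  moreover have "step g x = k (gradient h x - (1 / \<gamma>) *\<^sub>R g) - x" for g x
    using k(2)[of "x + step g x"] gradient_step[of x g] by simp
  ultimately show ?thesis
    by (auto simp: case_prod_beta intro!: continuous_intros continuous_on_compose2[OF cont]
        continuous_on_compose2[of UNIV k])
qed

end

section \<open>Geometry of the nearest-point projection\<close>

locale projection_geometry =
  fixes M :: "'a::euclidean_space set" and d :: nat and P :: "'a \<Rightarrow> 'a" and \<rho> M1 M2 M3 M4 :: real
  assumes emb: "embedded_submanifold d M"
    and near: "nearest_point_projection M P"
    and proj_consts: "projection_constants M P \<rho> M1 M2 M3 M4"
begin

abbreviation "T x \<equiv> tangent_space M x"
abbreviation "N x \<equiv> normal_space M x"

lemma consts_pos: "M1 > 0" "M2 > 0" "M3 > 0" "M4 > 0"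
  using proj_consts by (auto simp: projection_constants_def)

lemma P_in: "P z \<in> M" and P_nearest: "y \<in> M \<Longrightarrow> dist z (P z) \<le> dist z y"
  using near by (auto simp: nearest_point_projection_def)

lemma subspace_T: "x \<in> M \<Longrightarrow> subspace (T x)"
  using emb by (rule subspace_tangent_space)

lemma subspace_N: "subspace (N x)"
  by (simp add: normal_space_def subspace_orthogonal_comp)

lemma residual_normal: "z - P z \<in> N (P z)"
  using P_in P_nearest by (intro nearest_residual_normal)

lemma P_fixed: "x \<in> M \<Longrightarrow> P x = x"
  using P_nearest[of x x] by simp

text \<open>A normal n at y sees only the normal component of the secant, which \<open>M4\<close>
  bounds quadratically.\<close>

lemma normal_secant:
  assumes "x \<in> M" "y \<in> M" "n \<in> N y"
  shows "\<bar>n \<bullet> (x - y)\<bar> \<le> norm n * (M4 * (norm (x - y))\<^sup>2)"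
proof -
  have "n \<bullet> (y - x) = n \<bullet> orth_proj (N y) (y - x)"
    using inner_orth_proj[OF subspace_N assms(3)] by simp
  then have "\<bar>n \<bullet> (y - x)\<bar> \<le> norm n * norm (orth_proj (N y) (y - x))"
    by (simp add: Cauchy_Schwarz_ineq2)
  also have "\<dots> \<le> norm n * (M4 * (norm (y - x))\<^sup>2)"
    using proj_consts assms by (intro mult_left_mono) (auto simp: projection_constants_def)
  finally show ?thesis by (simp add: norm_minus_commute inner_diff_right abs_minus_commute)
qed

lemma retraction_bounds:
  assumes "x \<in> M" "v \<in> T x"
  shows "norm (P (x + v) - x) \<le> M1 * norm v" "norm (P (x + v) - x - v) \<le> M2 * (norm v)\<^sup>2"
proof -
  have "0 \<in> N x" "norm (0::'a) \<le> \<rho> / 2" using subspace_N subspace_0 proj_consts by (auto simp: projection_constants_def)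
  then have "norm (P (x + v + 0) - x) \<le> M1 * norm v \<and>
        norm (P (x + v + 0) - x - v) \<le> M2 * (norm v)\<^sup>2 + M3 * norm v * norm (0::'a)"
    using proj_consts assms unfolding projection_constants_def by blast
  then show "norm (P (x + v) - x) \<le> M1 * norm v" "norm (P (x + v) - x - v) \<le> M2 * (norm v)\<^sup>2" by auto
qed

text \<open>To first order P moves x by the full tangent vector, so a Lipschitz factor below 1 is
  impossible. The bound lets \<open>M4\<close> be absorbed into the term with \<open>M1\<close>
  squared times \<open>M4\<close> in \<open>Psi2\<close>.\<close>

lemma M1_ge_1:
  assumes x: "x \<in> M" and v: "v \<in> T x" "v \<noteq> 0"
  shows "M1 \<ge> 1"
proof (rule ccontr)
  assume "\<not> M1 \<ge> 1"
  \<comment> \<open>With this length the second-order error takes up only half of the gap 1 -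
    \<open>M1\<close>.\<close>
  define \<tau> where "\<tau> = (1 - M1) / (2 * M2 * norm v)"
  have \<tau>: "\<tau> > 0" using \<open>\<not> M1 \<ge> 1\<close> consts_pos v by (simp add: \<tau>_def)
  have t: "\<tau> *\<^sub>R v \<in> T x" using subspace_T[OF x] v(1) by (simp add: subspace_scale)
  have "norm (\<tau> *\<^sub>R v) \<le> M1 * norm (\<tau> *\<^sub>R v) + M2 * (norm (\<tau> *\<^sub>R v))\<^sup>2"
    using retraction_bounds[OF x t] norm_triangle_ineq4[of "P (x + \<tau> *\<^sub>R v) - x" "P (x + \<tau> *\<^sub>R v) - x - \<tau> *\<^sub>R v"] by simp
  then have "(\<tau> * norm v) * 1 \<le> (\<tau> * norm v) * (M1 + M2 * (\<tau> * norm v))"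
    using \<tau> by (simp add: power2_eq_square algebra_simps)
  then have "1 \<le> M1 + M2 * (\<tau> * norm v)"
    by (rule mult_left_le_imp_le) (use \<tau> v(2) in simp)
  also have "M2 * (\<tau> * norm v) = (1 - M1) / 2" using consts_pos v(2) by (simp add: \<tau>_def field_simps)
  finally show False using \<open>\<not> M1 \<ge> 1\<close> by (simp add: field_simps)
qed

text \<open>The three errors in \<open>tangent_normal_angle\<close>: \<open>M4\<close> * (1 +
  \<open>M1\<close>)^2 from the secant w - y, \<open>M4\<close> from the secant x - y, and
  \<open>M2\<close> from the retraction.\<close>

definition K :: real where "K = M4 * ((1 + M1)\<^sup>2 + 1) + M2"

lemma K_pos: "K > 0"
  using consts_pos by (simp add: K_def add_pos_pos)

text \<open>Testing the secant estimate at \<open>y\<close> against the points \<open>P (x + v)\<close> of \<open>M\<close> near \<open>x\<close>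
  shows that tangent and normal spaces at nearby points are almost orthogonal.\<close>

lemma tangent_normal_angle:
  assumes x: "x \<in> M" and y: "y \<in> M" and n: "n \<in> N y" and v: "v \<in> T x"
  shows "\<bar>n \<bullet> v\<bar> \<le> K * norm n * norm v * norm (x - y)"
proof (cases "x = y \<or> v = 0")
  case True
  then show ?thesis using n v by (auto simp: normal_space_def orthogonal_comp_def orthogonal_def inner_commute)
next
  case False
  define D where "D = norm (x - y)"
  \<comment> \<open>Scaling v to the length D of x - y makes all three errors of order D^2; dividing
    by \<tau> leaves one factor D and one factor norm v.\<close>
  define \<tau> where "\<tau> = D / norm v"
  have D: "D > 0" "\<tau> > 0" "\<tau> * norm v = D" using False by (auto simp: D_def \<tau>_def)
  have t: "\<tau> *\<^sub>R v \<in> T x" using subspace_T[OF x] v by (simp add: subspace_scale)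
  have nt: "norm (\<tau> *\<^sub>R v) = D" using D by simp
  define w where "w = P (x + \<tau> *\<^sub>R v)"
  have w: "w \<in> M" "norm (w - x) \<le> M1 * D" "norm (w - x - \<tau> *\<^sub>R v) \<le> M2 * D\<^sup>2"
    using retraction_bounds[OF x t] P_in nt by (auto simp: w_def)
  have "norm (w - y) \<le> (1 + M1) * D"
    using norm_triangle_ineq[of "w - x" "x - y"] w(2) by (simp add: D_def algebra_simps)
  then have "(norm (w - y))\<^sup>2 \<le> ((1 + M1) * D)\<^sup>2" by (intro power_mono) auto
  then have "norm n * (M4 * (norm (w - y))\<^sup>2) \<le> norm n * (M4 * ((1 + M1)\<^sup>2 * D\<^sup>2))"
    using consts_pos by (intro mult_left_mono) (auto simp: power_mult_distrib)
  then have 1: "\<bar>n \<bullet> (w - y)\<bar> \<le> norm n * (M4 * ((1 + M1)\<^sup>2 * D\<^sup>2))"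
    using normal_secant[OF w(1) y n] by linarith
  have 2: "\<bar>n \<bullet> (x - y)\<bar> \<le> norm n * (M4 * D\<^sup>2)"
    using normal_secant[OF x y n] by (simp add: D_def)
  have 3: "\<bar>n \<bullet> (w - x - \<tau> *\<^sub>R v)\<bar> \<le> norm n * (M2 * D\<^sup>2)"
    using Cauchy_Schwarz_ineq2[of n "w - x - \<tau> *\<^sub>R v"] w(3) by (meson mult_left_mono norm_ge_zero order_trans)
  have "\<tau> * (n \<bullet> v) = n \<bullet> (w - y) - n \<bullet> (x - y) - n \<bullet> (w - x - \<tau> *\<^sub>R v)"
    by (simp add: inner_diff_right)
  then have "\<bar>\<tau> * (n \<bullet> v)\<bar> \<le> norm n * (M4 * ((1 + M1)\<^sup>2 * D\<^sup>2)) + norm n * (M4 * D\<^sup>2) + norm n * (M2 * D\<^sup>2)"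
    using 1 2 3 by linarith
  also have "\<dots> = \<tau> * (K * norm n * norm v * D)"
    unfolding D(3)[symmetric] K_def by (simp add: power2_eq_square algebra_simps)
  finally have "\<tau> * \<bar>n \<bullet> v\<bar> \<le> \<tau> * (K * norm n * norm v * D)" using D(2) by (simp add: abs_mult)
  then show ?thesis using D(2) by (simp add: D_def)
qed

text \<open>Split w at y into its normal part n and tangent part q. The difference of the
  projections is the part of n tangent at x minus the part of q normal at x, and each is small by
  the angle estimate. This continuity in the base point is what makes Riemannian gradients
  measurable.\<close>

lemma orth_proj_tangent_lipschitz:
  assumes x: "x \<in> M" and y: "y \<in> M"
  shows "norm (orth_proj (T x) w - orth_proj (T y) w) \<le> 2 * K * norm w * norm (x - y)"
proof -
  let ?A = "orth_proj (T x)" and ?B = "orth_proj (T y)"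
  have sx: "subspace (T x)" and sy: "subspace (T y)" using x y subspace_T by auto
  have comp: "u - ?A u \<in> N x" "u - ?B u \<in> N y" for u
    using sx sy orth_proj_residual by (auto simp: normal_space_def)
  define n where "n = w - ?B w"
  have n: "n \<in> N y" "norm n \<le> norm w"
    using comp norm_orth_proj_le[OF subspace_N, of y w] orth_proj_comp[OF sy, of w]
    by (auto simp: n_def normal_space_def)
  have "(norm (?A n))\<^sup>2 = n \<bullet> ?A n"
    using inner_orth_proj[OF sx orth_proj_in[OF sx], of n n] by (simp add: dot_square_norm inner_commute)
  also have "\<dots> \<le> K * norm n * norm (?A n) * norm (x - y)"
    using tangent_normal_angle[OF x y n(1) orth_proj_in[OF sx], of n] by linarith
  finally have "norm (?A n) * norm (?A n) \<le> norm (?A n) * (K * norm n * norm (x - y))"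
    by (simp add: power2_eq_square algebra_simps)
  then have "norm (?A n) \<le> K * norm n * norm (x - y)"
    using K_pos by (cases "norm (?A n) = 0") auto
  also have "\<dots> \<le> K * norm w * norm (x - y)"
    using n(2) K_pos by (intro mult_right_mono mult_left_mono) auto
  finally have 1: "norm (?A n) \<le> K * norm w * norm (x - y)" .
  define q where "q = ?B w"
  define m where "m = q - ?A q"
  have q: "q \<in> T y" "norm q \<le> norm w" using sy orth_proj_in norm_orth_proj_le by (auto simp: q_def)
  have m: "m \<in> N x" using comp by (simp add: m_def)
  have "(norm m)\<^sup>2 = m \<bullet> q"
    using inner_orth_proj_residual[OF sx orth_proj_in[OF sx], of q q]
    by (simp add: power2_norm_eq_inner m_def inner_diff_right inner_diff_left inner_commute)
  also have "\<dots> \<le> K * norm m * norm q * norm (y - x)"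
    using tangent_normal_angle[OF y x m q(1)] by linarith
  finally have "norm m * norm m \<le> norm m * (K * norm q * norm (x - y))"
    by (simp add: power2_eq_square algebra_simps norm_minus_commute)
  then have "norm m \<le> K * norm q * norm (x - y)"
    using K_pos by (cases "norm m = 0") auto
  also have "\<dots> \<le> K * norm w * norm (x - y)"
    using q(2) K_pos by (intro mult_right_mono mult_left_mono) auto
  finally have 2: "norm m \<le> K * norm w * norm (x - y)" .
  have "?A w = ?A n + ?A q" using orth_proj_add[OF sx, of n q] by (simp add: n_def q_def)
  then have "?A w - ?B w = ?A n - m" by (simp add: m_def q_def)
  then show ?thesis using 1 2 norm_triangle_ineq4[of "?A n" m] by simp
qed

text \<open>Both residuals are normal at their feet, so pairing z1 - z2 with P z1 - P z2 gives D^2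
  up to two secant terms of at most D^2 / 4 each. Half of D^2 survives, whence the factor 2.\<close>

lemma P_lipschitz_near:
  assumes n: "norm (z1 - P z1) \<le> a" "norm (z2 - P z2) \<le> a" and a: "a * M4 \<le> 1 / 4"
  shows "norm (P z1 - P z2) \<le> 2 * norm (z1 - z2)"
proof -
  define D where "D = norm (P z1 - P z2)"
  have small: "norm (z - P z) * (M4 * D\<^sup>2) \<le> 1 / 4 * D\<^sup>2" if "norm (z - P z) \<le> a" for z
  proof -
    have "norm (z - P z) * M4 \<le> 1 / 4"
      using mult_right_mono[OF that, of M4] a consts_pos by linarith
    then have "(norm (z - P z) * M4) * D\<^sup>2 \<le> 1 / 4 * D\<^sup>2" by (rule mult_right_mono) simp
    then show ?thesis by (simp only: mult.assoc)
  qed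
  note small[OF n(1)] small[OF n(2)]
  moreover have "(z1 - P z1) \<bullet> (P z2 - P z1) \<le> norm (z1 - P z1) * (M4 * D\<^sup>2)"
    "(z2 - P z2) \<bullet> (P z1 - P z2) \<le> norm (z2 - P z2) * (M4 * D\<^sup>2)"
    using normal_secant[OF P_in P_in residual_normal, of z2 z1] normal_secant[OF P_in P_in residual_normal, of z1 z2]
    by (auto simp: D_def norm_minus_commute)
  moreover have "(z1 - z2) \<bullet> (P z1 - P z2) = D\<^sup>2 - (z1 - P z1) \<bullet> (P z2 - P z1) - (z2 - P z2) \<bullet> (P z1 - P z2)"
    unfolding D_def power2_norm_eq_inner by (simp add: inner_diff_left inner_diff_right inner_commute)
  moreover have "(z1 - z2) \<bullet> (P z1 - P z2) \<le> norm (z1 - z2) * D"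
    unfolding D_def by (rule norm_cauchy_schwarz)
  ultimately have "D * D \<le> D * (2 * norm (z1 - z2))" by (simp add: power2_eq_square algebra_simps)
  then show ?thesis unfolding D_def[symmetric] by (cases "D = 0") (auto simp: D_def)
qed

end

section \<open>Descent of a single noisy step\<close>

locale projected_bregman = projection_geometry M d P \<rho> M1 M2 M3 M4 + strongly_convex_step h lam \<gamma>
  for M :: "'a::euclidean_space set" and d P \<rho> M1 M2 M3 M4 and h :: "'a \<Rightarrow> real" and lam \<gamma> +
  fixes f :: "'a \<Rightarrow> real" and L \<alpha> :: real
  assumes M_compact: "compact M"
    and f_C1: "Ck_on 1 UNIV f" and h_C2: "Ck_on 2 UNIV h"
    and L_pos: "L > 0" and rel_smooth: "relatively_smooth L h f" and \<gamma>_ge: "\<gamma> \<ge> L"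
    and \<alpha>_pos: "0 < \<alpha>"
    and \<alpha>_le: "\<alpha> \<le> \<gamma> * lam / (8 * (\<gamma> * Psi1 M h M2 M3 + Psi2 M f M1 M2 M3 M4))"
begin

abbreviation "Gf \<equiv> max_grad_norm M f"
abbreviation "Hh \<equiv> max_hess_norm M h"
abbreviation "rgrad x \<equiv> orth_proj (T x) (gradient f x)"

lemma continuous_gradient_h: "continuous_on UNIV (gradient h)"
  using Ck_on_2_gradient(2)[OF h_C2] by (meson continuous_at_imp_continuous_on has_derivative_continuous)

lemma gradient_f_le: "x \<in> M \<Longrightarrow> norm (gradient f x) \<le> Gf"
  using gradient_le_max_grad_norm[OF Ck_on_1_gradient(2)[OF f_C1] M_compact] .

lemma rgrad_le: "x \<in> M \<Longrightarrow> norm (rgrad x) \<le> Gf"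
  using gradient_f_le norm_orth_proj_le[OF subspace_T] order_trans by blast

lemma hessian_le: "x \<in> M \<Longrightarrow> onorm (hessian h x) \<le> Hh"
  using onorm_hessian_le_max[OF h_C2 M_compact] .

text \<open>The cap on \<alpha> in the form in which curvature and projection errors consume it. A
  point of M guarantees that the suprema are nonnegative.\<close>

lemma step_size_bound:
  assumes "x \<in> M"
  shows "8 * \<alpha> * (\<gamma> * Hh + Gf * (M2 + M1\<^sup>2 * M4)) \<le> \<gamma> * lam" "Gf \<ge> 0" "Hh \<ge> 0"
proof -
  show G: "Gf \<ge> 0" using gradient_f_le[OF assms] norm_ge_zero order_trans by blast
  show H: "Hh \<ge> 0"
    using hessian_le[OF assms] onorm_pos_le[OF has_derivative_bounded_linear[OF Ck_on_2_gradient(2)[OF h_C2]]] order_trans by blast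
  have Gh: "max_grad_norm M h \<ge> 0"
    using gradient_le_max_grad_norm[OF continuous_gradient_h M_compact assms] norm_ge_zero order_trans by blast
  define \<Delta> where "\<Delta> = \<gamma> * Psi1 M h M2 M3 + Psi2 M f M1 M2 M3 M4"
  have "\<gamma> * Hh \<le> \<gamma> * Psi1 M h M2 M3" using Gh consts_pos \<gamma>_pos by (intro mult_left_mono) (auto simp: Psi1_def)
  moreover have "Gf * (M2 + M1\<^sup>2 * M4) \<le> Psi2 M f M1 M2 M3 M4"
    using G consts_pos mult_left_mono[of "M2 + M1\<^sup>2 * M4" "M2 + M3 + M1\<^sup>2 * M4" Gf] by (simp add: Psi2_def mult.commute)
  ultimately have le: "\<gamma> * Hh + Gf * (M2 + M1\<^sup>2 * M4) \<le> \<Delta>" by (simp add: \<Delta>_def)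
  have "\<gamma> * Hh + Gf * (M2 + M1\<^sup>2 * M4) \<ge> 0" using G H \<gamma>_pos consts_pos by simp
  \<comment> \<open>As division by 0 gives 0, a vanishing \<Delta> would turn the cap into \<alpha>
    \<le> 0.\<close>
  then have "\<Delta> > 0" using \<alpha>_pos \<alpha>_le le unfolding \<Delta>_def[symmetric] by (cases "\<Delta> = 0") auto
  then have "8 * \<alpha> * \<Delta> \<le> \<gamma> * lam" using \<alpha>_le unfolding \<Delta>_def[symmetric] by (simp add: field_simps)
  then show "8 * \<alpha> * (\<gamma> * Hh + Gf * (M2 + M1\<^sup>2 * M4)) \<le> \<gamma> * lam"
    using mult_left_mono[OF le, of "8 * \<alpha>"] \<alpha>_pos by linarith
qed

text \<open>The step alone promises a decrease of \<alpha> * \<gamma> * lam * norm \<zeta> ^ 2. All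
  errors are multiples of a^2, the square of the length of \<alpha> \<zeta>, and use up at most 7/8
  of it.\<close>

lemma descent_small_noise:
  assumes x: "x \<in> M" and e: "e \<in> T x" "norm e \<le> Gf"
    and \<zeta>: "\<zeta> = step (rgrad x + e) x"
  shows "f (P (x + \<alpha> *\<^sub>R \<zeta>)) \<le> f x - \<alpha> * \<gamma> * lam / 8 * (norm \<zeta>)\<^sup>2 - \<alpha> * (e \<bullet> \<zeta>)"
proof (cases "\<zeta> = 0")
  case True
  then show ?thesis using P_fixed[OF x] by simp
next
  case False
  define g where "g = rgrad x + e"
  have sx: "subspace (T x)" by (rule subspace_T[OF x])
  have gT: "g \<in> T x" using e sx orth_proj_in[OF sx] by (simp add: g_def subspace_add)
  have "g \<noteq> 0" using False \<zeta> step_zero by (auto simp: g_def)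
  then have M1: "M1 \<ge> 1" using M1_ge_1[OF x gT] by simp
  have Gf: "Gf \<ge> 0" and Hh: "Hh \<ge> 0" using step_size_bound[OF x] by auto
  have \<gamma>l: "\<gamma> * lam > 0" using \<gamma>_pos lam_pos by simp
  have M4le: "M4 \<le> M1\<^sup>2 * M4" using M1 consts_pos by (simp add: one_le_power)
  define a where "a = \<alpha> * norm \<zeta>"
  have a0: "a \<ge> 0" using \<alpha>_pos by (simp add: a_def)
  \<comment> \<open>Small noise enters here: the step is computed from a vector of length at most 2
    * \<open>Gf\<close>, so the cap on \<alpha> makes it short compared with 1 /
    \<open>M4\<close>.\<close>
  have aM4: "a * M4 \<le> 1 / 4"
  proof -
    have "norm g \<le> 2 * Gf" using norm_triangle_ineq[of "rgrad x" e] rgrad_le[OF x] e(2) by (simp add: g_def)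
    then have "norm \<zeta> \<le> 2 * Gf / (\<gamma> * lam)"
      using norm_step_le[of g x] \<gamma>l \<zeta> by (simp add: g_def field_simps)
    then have "norm \<zeta> * (\<gamma> * lam) \<le> 2 * Gf" using \<gamma>l by (simp add: field_simps)
    then have "(\<alpha> * M4) * (norm \<zeta> * (\<gamma> * lam)) \<le> (\<alpha> * M4) * (2 * Gf)"
      using \<alpha>_pos consts_pos by (intro mult_left_mono) auto
    also have "\<dots> \<le> 1 / 4 * (8 * \<alpha> * (\<gamma> * Hh + Gf * (M2 + M1\<^sup>2 * M4)))"
    proof -
      have "Gf * M4 \<le> Gf * (M2 + M1\<^sup>2 * M4)" using M4le consts_pos Gf by (intro mult_left_mono) linarith+
      moreover have "\<gamma> * Hh \<ge> 0" using \<gamma>_pos Hh by simp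
      ultimately have "2 * \<alpha> * (Gf * M4) \<le> 2 * \<alpha> * (\<gamma> * Hh + Gf * (M2 + M1\<^sup>2 * M4))"
        using \<alpha>_pos by (intro mult_left_mono) auto
      then show ?thesis by (simp add: algebra_simps)
    qed
    also have "\<dots> \<le> 1 / 4 * (\<gamma> * lam)" using step_size_bound(1)[OF x] by (intro mult_left_mono) auto
    finally have "(a * M4) * (\<gamma> * lam) \<le> 1 / 4 * (\<gamma> * lam)" by (simp add: a_def algebra_simps)
    then show ?thesis using \<gamma>l by (rule mult_right_le_imp_le)
  qed
  define z where "z = x + \<alpha> *\<^sub>R \<zeta>"
  define y where "y = P z"
  define n where "n = z - y"
  define D where "D = norm (y - x)"
  have y: "y \<in> M" by (simp add: y_def P_in)
  have nN: "n \<in> N y" by (simp add: n_def y_def residual_normal)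
  have na: "norm n \<le> a"
    using P_nearest[OF x, of z] \<alpha>_pos by (simp add: n_def y_def dist_norm a_def z_def)
  \<comment> \<open>The displacement z - x equals n - (x - y). In the expansion of its squared norm
    the mixed term is at most D^2 / 2 by the secant bound, so the two legs are nearly
    orthogonal.\<close>
  have pythagoras: "(norm n)\<^sup>2 + D\<^sup>2 / 2 \<le> a\<^sup>2"
  proof -
    have "norm n * (M4 * D\<^sup>2) \<le> 1 / 4 * D\<^sup>2"
    proof -
      have "norm n * M4 \<le> 1 / 4" using mult_right_mono[OF na, of M4] aM4 consts_pos by linarith
      then have "(norm n * M4) * D\<^sup>2 \<le> 1 / 4 * D\<^sup>2" by (rule mult_right_mono) simp
      then show ?thesis by (simp only: mult.assoc)
    qed
    then have "n \<bullet> (x - y) \<le> 1 / 4 * D\<^sup>2"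
      using normal_secant[OF x y nN] by (simp add: D_def norm_minus_commute)
    moreover have "a\<^sup>2 = (norm (n - (x - y)))\<^sup>2" using \<alpha>_pos by (simp add: a_def n_def z_def)
    moreover have "(norm (n - (x - y)))\<^sup>2 = (norm n)\<^sup>2 + D\<^sup>2 - 2 * (n \<bullet> (x - y))"
      unfolding D_def norm_minus_commute[of y x] power2_norm_eq_inner
      by (simp add: inner_diff_left inner_diff_right inner_commute)
    ultimately show ?thesis by simp
  qed
  have D2: "D\<^sup>2 \<le> 2 * a\<^sup>2" using pythagoras zero_le_power2[of "norm n"] by linarith
  have nD: "norm n * D \<le> a\<^sup>2"
  proof -
    have "0 \<le> (norm n - D / 2)\<^sup>2" by simp
    also have "\<dots> = (norm n)\<^sup>2 + D\<^sup>2 / 4 - norm n * D" by (simp add: power2_diff power_divide)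
    finally show ?thesis using pythagoras zero_le_power2[of D] by linarith
  qed
  have breg: "bregman h y x \<le> Hh * (2 * a)\<^sup>2"
  proof -
    \<comment> \<open>The projection of the straight segment from x to z: it stays in M, joins x to
      y and is Lipschitz with constant 2 * a.\<close>
    define p where "p r = P (x + r *\<^sub>R (\<alpha> *\<^sub>R \<zeta>))" for r :: real
    have "bregman h (p 1) (p 0) \<le> Hh * (2 * a)\<^sup>2"
    proof (rule bregman_le_along_lipschitz_path[OF h_C2 hessian_le])
      show "p ` {0..1} \<subseteq> M" by (auto simp: p_def P_in)
      fix r s :: real assume rs: "r \<in> {0..1}" "s \<in> {0..1}"
      have near: "norm (x + r *\<^sub>R (\<alpha> *\<^sub>R \<zeta>) - P (x + r *\<^sub>R (\<alpha> *\<^sub>R \<zeta>))) \<le> a" if "r \<in> {0..1}" for r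
      proof -
        have "norm (x + r *\<^sub>R (\<alpha> *\<^sub>R \<zeta>) - P (x + r *\<^sub>R (\<alpha> *\<^sub>R \<zeta>))) \<le> r * a"
          using P_nearest[OF x, of "x + r *\<^sub>R (\<alpha> *\<^sub>R \<zeta>)"] that \<alpha>_pos by (simp add: dist_norm a_def)
        also have "\<dots> \<le> a" using that a0 by (simp add: mult_left_le_one_le)
        finally show ?thesis .
      qed
      have "norm (p s - p r) \<le> 2 * norm ((x + s *\<^sub>R (\<alpha> *\<^sub>R \<zeta>)) - (x + r *\<^sub>R (\<alpha> *\<^sub>R \<zeta>)))"
        unfolding p_def by (rule P_lipschitz_near[OF near[OF rs(2)] near[OF rs(1)] aM4])
      also have "(x + s *\<^sub>R (\<alpha> *\<^sub>R \<zeta>)) - (x + r *\<^sub>R (\<alpha> *\<^sub>R \<zeta>)) = (s - r) *\<^sub>R (\<alpha> *\<^sub>R \<zeta>)"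
        by (simp add: algebra_simps)
      also have "norm \<dots> = a * \<bar>s - r\<bar>" using \<alpha>_pos by (simp add: a_def abs_mult)
      finally show "norm (p s - p r) \<le> 2 * a * \<bar>s - r\<bar>" by simp
    qed (use a0 in auto)
    then show ?thesis by (simp add: p_def y_def z_def P_fixed[OF x])
  qed
  \<comment> \<open>The first-order term splits into the pairing of \<open>rgrad x\<close> with the
    step, the pairing of \<open>rgrad x\<close> (tangent at x) with n (normal at y), and that of m
    (normal at x) with y - x. The last two are the errors \<open>err2\<close> and
    \<open>err1\<close>.\<close>
  define m where "m = gradient f x - rgrad x"
  have mN: "m \<in> N x" using orth_proj_residual[OF sx] by (simp add: m_def normal_space_def)
  have "norm m \<le> norm (gradient f x)"
    using norm_orth_proj_le[OF subspace_N, of x "gradient f x"] orth_proj_comp[OF sx, of "gradient f x"]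
    by (simp add: m_def normal_space_def)
  then have mG: "norm m \<le> Gf" using gradient_f_le[OF x] by linarith
  have "m \<bullet> (y - x) \<le> norm m * (M4 * D\<^sup>2)"
    using normal_secant[OF y x mN] by (simp add: D_def)
  also have "\<dots> \<le> Gf * (M4 * (2 * a\<^sup>2))"
    using mG D2 consts_pos Gf by (intro mult_mono) auto
  finally have err1: "m \<bullet> (y - x) \<le> a\<^sup>2 * (Gf * (2 * M4))" by (simp add: algebra_simps)
  have err2: "- (rgrad x \<bullet> n) \<le> a\<^sup>2 * (Gf * K)"
  proof -
    have "- (n \<bullet> rgrad x) \<le> K * norm n * norm (rgrad x) * D"
      using tangent_normal_angle[OF x y nN orth_proj_in[OF sx], of "gradient f x"]
      by (simp add: D_def norm_minus_commute)
    also have "\<dots> = (norm n * D) * (K * norm (rgrad x))" by simp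
    also have "\<dots> \<le> a\<^sup>2 * (K * Gf)"
      using nD rgrad_le[OF x] K_pos by (intro mult_mono mult_left_mono) (auto simp: D_def)
    finally show ?thesis by (simp add: inner_commute mult.commute)
  qed
  have err3: "L * bregman h y x \<le> a\<^sup>2 * (4 * \<gamma> * Hh)"
  proof -
    have "L * bregman h y x \<le> L * (Hh * (2 * a)\<^sup>2)" using breg L_pos by (intro mult_left_mono) auto
    also have "\<dots> \<le> \<gamma> * (Hh * (2 * a)\<^sup>2)" using \<gamma>_ge Hh by (intro mult_right_mono) auto
    finally show ?thesis by (simp add: power2_eq_square algebra_simps)
  qed
  have main: "rgrad x \<bullet> \<zeta> \<le> - \<gamma> * lam * (norm \<zeta>)\<^sup>2 - e \<bullet> \<zeta>"
    using step_descent[of g x] \<zeta> by (simp add: g_def inner_add_left)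
  have yx: "y - x = \<alpha> *\<^sub>R \<zeta> - n" by (simp add: n_def z_def)
  have "f y \<le> f x + gradient f x \<bullet> (y - x) + L * bregman h y x"
    using rel_smooth by (simp add: relatively_smooth_def)
  also have "gradient f x \<bullet> (y - x) = \<alpha> * (rgrad x \<bullet> \<zeta>) - rgrad x \<bullet> n + m \<bullet> (y - x)"
    unfolding m_def inner_diff_left[of "gradient f x"] by (simp add: yx inner_diff_right)
  finally have "f y \<le> f x + \<alpha> * (rgrad x \<bullet> \<zeta>) + a\<^sup>2 * (4 * \<gamma> * Hh + Gf * (2 * M4 + K))"
    using err1 err2 err3 by (simp add: algebra_simps)
  also have "\<alpha> * (rgrad x \<bullet> \<zeta>) \<le> \<alpha> * (- \<gamma> * lam * (norm \<zeta>)\<^sup>2 - e \<bullet> \<zeta>)"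
    using main \<alpha>_pos by (intro mult_left_mono) auto
  \<comment> \<open>From \<open>M1\<close> \<ge> 1, K is at most 4 * (\<open>M1\<close>^2 *
    \<open>M4\<close>) + \<open>M4\<close> + \<open>M2\<close>, so 2 * \<open>M4\<close> + K is at
    most 7 * (\<open>M2\<close> + \<open>M1\<close>^2 * \<open>M4\<close>). The 7 meets the 8 of the
    step-size cap.\<close>
  also have "a\<^sup>2 * (4 * \<gamma> * Hh + Gf * (2 * M4 + K)) \<le> 7 / 8 * (\<alpha> * \<gamma> * lam * (norm \<zeta>)\<^sup>2)"
  proof -
    have "(1 + M1)\<^sup>2 \<le> 4 * M1\<^sup>2"
      using power_mono[of "1 + M1" "2 * M1" 2] M1 by (simp add: power_mult_distrib)
    then have "M4 * (1 + M1)\<^sup>2 \<le> M4 * (4 * M1\<^sup>2)" using consts_pos by (intro mult_left_mono) auto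
    also have "\<dots> = 4 * (M1\<^sup>2 * M4)" by simp
    finally have "K \<le> 4 * (M1\<^sup>2 * M4) + M4 + M2" by (simp add: K_def distrib_left)
    moreover have "7 * (M2 + M1\<^sup>2 * M4) = 7 * M2 + 7 * (M1\<^sup>2 * M4)" by (rule distrib_left)
    ultimately have "2 * M4 + K \<le> 7 * (M2 + M1\<^sup>2 * M4)"
      using M4le consts_pos by linarith
    then have "Gf * (2 * M4 + K) \<le> Gf * (7 * (M2 + M1\<^sup>2 * M4))" using Gf by (intro mult_left_mono) auto
    moreover have "4 * \<gamma> * Hh \<le> 7 * \<gamma> * Hh" using \<gamma>_pos Hh by simp
    ultimately have "4 * \<gamma> * Hh + Gf * (2 * M4 + K) \<le> 7 * (\<gamma> * Hh + Gf * (M2 + M1\<^sup>2 * M4))"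
      by (simp add: algebra_simps)
    then have "\<alpha> * (4 * \<gamma> * Hh + Gf * (2 * M4 + K)) \<le> \<alpha> * (7 * (\<gamma> * Hh + Gf * (M2 + M1\<^sup>2 * M4)))"
      using \<alpha>_pos by (intro mult_left_mono) auto
    also have "\<dots> = 7 / 8 * (8 * \<alpha> * (\<gamma> * Hh + Gf * (M2 + M1\<^sup>2 * M4)))" by simp
    also have "\<dots> \<le> 7 / 8 * (\<gamma> * lam)" by (rule mult_left_mono[OF step_size_bound(1)[OF x]]) simp
    finally have "(\<alpha> * (norm \<zeta>)\<^sup>2) * (\<alpha> * (4 * \<gamma> * Hh + Gf * (2 * M4 + K))) \<le> (\<alpha> * (norm \<zeta>)\<^sup>2) * (7 / 8 * (\<gamma> * lam))"
      using \<alpha>_pos by (intro mult_left_mono) auto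
    then show ?thesis by (simp add: a_def power2_eq_square algebra_simps)
  qed
  finally show ?thesis unfolding y_def z_def by (simp add: algebra_simps)
qed

text \<open>The nearest point moves at most twice as far as the step itself, so a noise that
  dominates the gradient bound is absorbed by its own square.\<close>

lemma ascent_large_noise:
  obtains C where "C \<ge> 0"
    and "\<And>x e \<zeta>. x \<in> M \<Longrightarrow> Gf \<le> norm e \<Longrightarrow> \<zeta> = step (rgrad x + e) x \<Longrightarrow>
      f (P (x + \<alpha> *\<^sub>R \<zeta>)) \<le> f x + C * (norm e)\<^sup>2"
proof -
  obtain Kh where Kh: "Kh \<ge> 0" "\<And>x y. x \<in> M \<Longrightarrow> y \<in> M \<Longrightarrow> bregman h y x \<le> Kh * (norm (y - x))\<^sup>2"
    using bregman_quadratic_bound_on_compact[OF h_C2 M_compact] by metis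
  \<comment> \<open>The displacement is at most twice \<alpha> \<zeta>, and the vector defining
    \<zeta> is at most twice the noise; the two factors 2 give the 4.\<close>
  define \<beta> where "\<beta> = 4 * \<alpha> / (\<gamma> * lam)"
  have \<beta>: "\<beta> \<ge> 0" using \<alpha>_pos \<gamma>_pos lam_pos by (simp add: \<beta>_def)
  have "f (P (x + \<alpha> *\<^sub>R \<zeta>)) \<le> f x + (\<beta> + L * Kh * \<beta>\<^sup>2) * (norm e)\<^sup>2"
    if x: "x \<in> M" and e: "Gf \<le> norm e" and \<zeta>: "\<zeta> = step (rgrad x + e) x" for x e \<zeta>
  proof -
    define y where "y = P (x + \<alpha> *\<^sub>R \<zeta>)"
    have y: "y \<in> M" by (simp add: y_def P_in)
    have "norm (x + \<alpha> *\<^sub>R \<zeta> - y) \<le> norm (\<alpha> *\<^sub>R \<zeta>)"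
      using P_nearest[OF x, of "x + \<alpha> *\<^sub>R \<zeta>"] by (simp add: y_def dist_norm)
    then have "norm (y - x) \<le> 2 * norm (\<alpha> *\<^sub>R \<zeta>)"
      using norm_triangle_ineq4[of "\<alpha> *\<^sub>R \<zeta>" "x + \<alpha> *\<^sub>R \<zeta> - y"] by simp
    also have "\<dots> = 2 * \<alpha> * norm \<zeta>" using \<alpha>_pos by simp
    also have "\<dots> \<le> 2 * \<alpha> * (2 * norm e / (\<gamma> * lam))"
    proof (intro mult_left_mono)
      have "norm (rgrad x + e) \<le> 2 * norm e"
        using norm_triangle_ineq[of "rgrad x" e] rgrad_le[OF x] e by linarith
      then have "norm (rgrad x + e) / (\<gamma> * lam) \<le> 2 * norm e / (\<gamma> * lam)"
        using \<gamma>_pos lam_pos by (intro divide_right_mono) auto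
      then show "norm \<zeta> \<le> 2 * norm e / (\<gamma> * lam)" using norm_step_le[of "rgrad x + e" x] unfolding \<zeta> by linarith
    qed (use \<alpha>_pos in auto)
    finally have D: "norm (y - x) \<le> \<beta> * norm e" by (simp add: \<beta>_def)
    have "f y \<le> f x + gradient f x \<bullet> (y - x) + L * bregman h y x"
      using rel_smooth by (simp add: relatively_smooth_def)
    moreover have "gradient f x \<bullet> (y - x) \<le> norm e * (\<beta> * norm e)"
      using norm_cauchy_schwarz[of "gradient f x" "y - x"] D gradient_f_le[OF x] e
        mult_mono[of "norm (gradient f x)" "norm e" "norm (y - x)" "\<beta> * norm e"] by simp
    moreover have "L * bregman h y x \<le> L * (Kh * (\<beta> * norm e)\<^sup>2)"
    proof (intro mult_left_mono)
      show "bregman h y x \<le> Kh * (\<beta> * norm e)\<^sup>2"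
        using Kh(2)[OF x y] mult_left_mono[OF power_mono[OF D, of 2] Kh(1)] by simp
    qed (use L_pos in simp)
    ultimately show ?thesis unfolding y_def[symmetric] by (simp add: power2_eq_square algebra_simps)
  qed
  then show thesis using \<beta> Kh(1) L_pos by (intro that[of "\<beta> + L * Kh * \<beta>\<^sup>2"]) auto
qed

abbreviation "vstep x \<equiv> stationarity_step M f h \<gamma> x"

text \<open>The linear noise term is isolated with a factor depending on \<open>x\<close> only, so that it has
  mean zero.\<close>

lemma noisy_descent:
  obtains c C where "c > 0" "C \<ge> 0"
    and "\<And>x s. x \<in> M \<Longrightarrow> f (P (x + \<alpha> *\<^sub>R step (orth_proj (T x) (gradient f x + s)) x))
      \<le> f x - c * (norm (vstep x))\<^sup>2 - \<alpha> * (s \<bullet> orth_proj (T x) (vstep x)) + C * (norm s)\<^sup>2"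
proof -
  obtain C0 where C0: "C0 \<ge> 0" "\<And>x e \<zeta>. x \<in> M \<Longrightarrow> Gf \<le> norm e \<Longrightarrow> \<zeta> = step (rgrad x + e) x \<Longrightarrow>
      f (P (x + \<alpha> *\<^sub>R \<zeta>)) \<le> f x + C0 * (norm e)\<^sup>2"
    using ascent_large_noise by blast
  define k where "k = \<gamma> * lam"
  have k: "k > 0" using \<gamma>_pos lam_pos by (simp add: k_def)
  \<comment> \<open>Half of the coefficient \<alpha> * k / 8 from
    \<open>descent_small_noise\<close>: passing from \<zeta> to v bounds norm v ^ 2 by twice norm
    \<zeta> ^ 2 plus noise.\<close>
  define c where "c = \<alpha> * k / 16"
  have c: "c > 0" using k \<alpha>_pos by (simp add: c_def)
  \<comment> \<open>\<open>C0\<close> pays for large noise, c / k^2 for the v-term in that case, and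
    2 * \<alpha> / k for the products of e with \<zeta> - v or with v and for the remainder of the
    small-noise case.\<close>
  define C where "C = C0 + c / k\<^sup>2 + 2 * \<alpha> / k"
  have C: "C \<ge> 0" using C0(1) c k \<alpha>_pos by (simp add: C_def)
  have "f (P (x + \<alpha> *\<^sub>R step (orth_proj (T x) (gradient f x + s)) x))
      \<le> f x - c * (norm (vstep x))\<^sup>2 - \<alpha> * (s \<bullet> orth_proj (T x) (vstep x)) + C * (norm s)\<^sup>2"
    if x: "x \<in> M" for x s
  proof -
    have sx: "subspace (T x)" by (rule subspace_T[OF x])
    define e where "e = orth_proj (T x) s"
    have eT: "e \<in> T x" by (simp add: e_def orth_proj_in[OF sx])
    have es: "norm e \<le> norm s" by (simp add: e_def norm_orth_proj_le[OF sx])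
    define v where "v = vstep x"
    define \<zeta> where "\<zeta> = step (rgrad x + e) x"
    have v: "v = step (rgrad x) x" by (simp add: v_def stationarity_step_def)
    \<comment> \<open>The projection is self-adjoint, so it moves from the noise to v, which need
      not be tangent. The raw noise s then stands against a factor determined by x.\<close>
    have ev: "s \<bullet> orth_proj (T x) v = e \<bullet> v"
      using inner_orth_proj[OF sx eT, of v] inner_orth_proj[OF sx orth_proj_in[OF sx], of v s]
      by (simp add: e_def inner_commute)
    have \<zeta>v: "norm (\<zeta> - v) \<le> norm e / k"
      using step_lipschitz[of "rgrad x + e" x "rgrad x"] by (simp add: \<zeta>_def v k_def)
    have main: "f (P (x + \<alpha> *\<^sub>R \<zeta>)) \<le> f x - c * (norm v)\<^sup>2 - \<alpha> * (e \<bullet> v) + C * (norm e)\<^sup>2"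
    proof (cases "norm e \<le> Gf")
      case True
      have "norm v \<le> norm \<zeta> + norm e / k" using norm_triangle_ineq4[of \<zeta> "\<zeta> - v"] \<zeta>v by simp
      then have "(norm v)\<^sup>2 \<le> (norm \<zeta> + norm e / k)\<^sup>2" by (intro power_mono) auto
      also have "\<dots> \<le> 2 * (norm \<zeta>)\<^sup>2 + 2 * (norm e / k)\<^sup>2"
        using sum_squares_bound[of "norm \<zeta>" "norm e / k"] by (simp add: power2_sum)
      finally have "c * (norm v)\<^sup>2 \<le> c * (2 * (norm \<zeta>)\<^sup>2 + 2 * (norm e / k)\<^sup>2)" using c by (intro mult_left_mono) auto
      also have "\<dots> = \<alpha> * k / 8 * (norm \<zeta>)\<^sup>2 + \<alpha> / (8 * k) * (norm e)\<^sup>2"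
        using k by (simp add: c_def power_divide power2_eq_square field_simps)
      finally have 1: "c * (norm v)\<^sup>2 \<le> \<alpha> * \<gamma> * lam / 8 * (norm \<zeta>)\<^sup>2 + \<alpha> / (8 * k) * (norm e)\<^sup>2"
        by (simp add: k_def)
      have "- (e \<bullet> (\<zeta> - v)) \<le> norm e * (norm e / k)"
        using Cauchy_Schwarz_ineq2[of e "\<zeta> - v"] mult_left_mono[OF \<zeta>v norm_ge_zero[of e]] by linarith
      then have "\<alpha> * - (e \<bullet> (\<zeta> - v)) \<le> \<alpha> * (norm e * (norm e / k))" using \<alpha>_pos by (intro mult_left_mono) auto
      then have 2: "- (\<alpha> * (e \<bullet> \<zeta>)) \<le> - (\<alpha> * (e \<bullet> v)) + \<alpha> / k * (norm e)\<^sup>2"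
        by (simp add: inner_diff_right power2_eq_square algebra_simps)
      have "\<alpha> / (8 * k) + \<alpha> / k \<le> C" using C0(1) c k \<alpha>_pos by (simp add: C_def field_simps)
      then have "(\<alpha> / (8 * k) + \<alpha> / k) * (norm e)\<^sup>2 \<le> C * (norm e)\<^sup>2" by (intro mult_right_mono) auto
      then show ?thesis
        using descent_small_noise[OF x eT True \<zeta>_def] 1 2 by (simp add: distrib_right)
    next
      case False
      \<comment> \<open>The large-noise bound does not mention v; here v is itself bounded by the
        noise, so both v-terms can be inserted at quadratic cost.\<close>
      have ve: "norm v \<le> norm e / k"
      proof -
        have "norm (rgrad x) / k \<le> norm e / k" using rgrad_le[OF x] False k by (intro divide_right_mono) auto
        then show ?thesis using norm_step_le[of "rgrad x" x] by (simp add: v k_def)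
      qed
      have 1: "c * (norm v)\<^sup>2 \<le> c / k\<^sup>2 * (norm e)\<^sup>2"
        using mult_left_mono[OF power_mono[OF ve, of 2], of c] c by (simp add: power_divide)
      have "e \<bullet> v \<le> norm e * (norm e / k)"
        using norm_cauchy_schwarz[of e v] mult_left_mono[OF ve norm_ge_zero[of e]] by linarith
      then have "\<alpha> * (e \<bullet> v) \<le> \<alpha> * (norm e * (norm e / k))" using \<alpha>_pos by (intro mult_left_mono) auto
      then have 2: "\<alpha> * (e \<bullet> v) \<le> \<alpha> / k * (norm e)\<^sup>2" by (simp add: power2_eq_square)
      have "C0 + c / k\<^sup>2 + \<alpha> / k \<le> C" using \<alpha>_pos k by (simp add: C_def field_simps)
      then have "(C0 + c / k\<^sup>2 + \<alpha> / k) * (norm e)\<^sup>2 \<le> C * (norm e)\<^sup>2" by (intro mult_right_mono) auto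
      then show ?thesis using C0(2)[OF x _ \<zeta>_def] False 1 2 by (simp add: distrib_right)
    qed
    moreover have "C * (norm e)\<^sup>2 \<le> C * (norm s)\<^sup>2" using es C by (intro mult_left_mono power_mono) auto
    moreover have "orth_proj (T x) (gradient f x + s) = rgrad x + e" by (simp add: e_def orth_proj_add[OF sx])
    ultimately show ?thesis using ev by (simp add: \<zeta>_def v_def)
  qed
  then show thesis using that[OF c C] by blast
qed

end

section \<open>Measurability and moments of the mini-batch noise\<close>

text \<open>Replace x by simple functions converging to the identity: each approximation is
  measurable piece by piece, and continuity in x passes to the limit.\<close>

lemma caratheodory_borel_measurable:
  fixes F :: "'a::euclidean_space \<Rightarrow> 'p \<Rightarrow> real"
  assumes meas: "\<And>x. F x \<in> borel_measurable D"
    and cont: "\<And>p. p \<in> space D \<Longrightarrow> continuous_on UNIV (\<lambda>x. F x p)"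
  shows "(\<lambda>(x, p). F x p) \<in> borel_measurable (borel \<Otimes>\<^sub>M D)"
proof -
  obtain s :: "nat \<Rightarrow> 'a \<Rightarrow> 'a" where s: "\<And>i. simple_function borel (s i)" "\<And>x. (\<lambda>i. s i x) \<longlonglongrightarrow> x"
    using borel_measurable_implies_sequence_metric[of "\<lambda>x::'a. x" borel 0] by auto
  show ?thesis
  proof (rule borel_measurable_LIMSEQ_real)
    fix z assume z: "z \<in> space (borel \<Otimes>\<^sub>M D :: ('a \<times> 'p) measure)"
    then have "isCont (\<lambda>x. F x (snd z)) (fst z)"
      using cont[of "snd z"] by (auto simp: space_pair_measure continuous_on_eq_continuous_at)
    then show "(\<lambda>i. F (s i (fst z)) (snd z)) \<longlonglongrightarrow> (case z of (x, p) \<Rightarrow> F x p)"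
      using isCont_tendsto_compose[OF _ s(2)] by (simp add: case_prod_beta)
  next
    fix i
    have fin: "finite (range (s i))" using simple_functionD(1)[OF s(1)] by simp
    have "s i \<in> measurable borel (count_space (range (s i)))"
      using s(1)[of i] fin by (auto simp: simple_function_def measurable_count_space_eq2)
    then have "(\<lambda>z. s i (fst z)) \<in> measurable (borel \<Otimes>\<^sub>M D) (count_space (range (s i)))"
      by (rule measurable_compose[OF measurable_fst])
    then show "(\<lambda>z. F (s i (fst z)) (snd z)) \<in> borel_measurable (borel \<Otimes>\<^sub>M D)"
      by (rule measurable_compose_countable'[rotated])
        (use fin meas in \<open>auto intro: countable_finite measurable_compose[OF measurable_snd]\<close>)
  qed
qed

text \<open>Each partial derivative is the limit of difference quotients with increments 1 / (n +
  1), which are jointly measurable since the sample function is.\<close>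

lemma sample_grad_jointly_measurable:
  fixes F :: "'a::euclidean_space \<Rightarrow> 'p \<Rightarrow> real"
  assumes meas: "\<And>x. F x \<in> borel_measurable D"
    and diff: "\<And>p x. p \<in> space D \<Longrightarrow> (\<lambda>y. F y p) differentiable (at x)"
  shows "(\<lambda>(x, p). sample_grad F x p) \<in> borel_measurable (borel \<Otimes>\<^sub>M D)"
proof -
  have F[measurable]: "(\<lambda>(x, p). F x p) \<in> borel_measurable (borel \<Otimes>\<^sub>M D)"
    using meas diff by (intro caratheodory_borel_measurable)
      (auto intro!: continuous_at_imp_continuous_on differentiable_imp_continuous_within)
  have comp: "(\<lambda>z. sample_grad F (fst z) (snd z) \<bullet> i) \<in> borel_measurable (borel \<Otimes>\<^sub>M D)" for i
  proof (rule borel_measurable_LIMSEQ_real)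
    fix z assume z: "z \<in> space (borel \<Otimes>\<^sub>M D :: ('a \<times> 'p) measure)"
    obtain x p where xp: "z = (x, p)" by (cases z)
    have p: "p \<in> space D" using z xp by (auto simp: space_pair_measure)
    have "((\<lambda>t. F (x + t *\<^sub>R i) p) has_derivative (\<lambda>t. gradient (\<lambda>y. F y p) x \<bullet> (t *\<^sub>R i))) (at 0)"
    proof (rule has_derivative_compose[where f = "\<lambda>t. x + t *\<^sub>R i"])
      show "((\<lambda>t. x + t *\<^sub>R i) has_derivative (\<lambda>t. t *\<^sub>R i)) (at 0)"
        by (auto intro!: derivative_eq_intros)
    qed (use has_derivative_gradient[OF diff[OF p, of x]] in simp)
    then have "((\<lambda>t. F (x + t *\<^sub>R i) p) has_real_derivative (sample_grad F x p \<bullet> i)) (at 0)"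
      by (simp add: has_field_derivative_def sample_grad_def mult.commute[of _ "_ \<bullet> _"])
    then have "(\<lambda>t. (F (x + t *\<^sub>R i) p - F x p) / t) \<midarrow>0\<rightarrow> sample_grad F x p \<bullet> i"
      by (simp add: DERIV_def)
    moreover have "filterlim (\<lambda>n. inverse (real (Suc n))) (at 0) sequentially"
      by (intro filterlim_atI LIMSEQ_inverse_real_of_nat) auto
    ultimately show "(\<lambda>n. (F (fst z + inverse (real (Suc n)) *\<^sub>R i) (snd z) - F (fst z) (snd z)) / inverse (real (Suc n)))
        \<longlonglongrightarrow> sample_grad F (fst z) (snd z) \<bullet> i"
      unfolding xp fst_conv snd_conv by (rule filterlim_compose)
  next
    fix n :: nat
    have "(\<lambda>z. (fst z + c *\<^sub>R i, snd z)) \<in> measurable (borel \<Otimes>\<^sub>M D) (borel \<Otimes>\<^sub>M D)" for c :: real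
      by measurable
    from measurable_compose[OF this F]
    have "(\<lambda>z. F (fst z + c *\<^sub>R i) (snd z)) \<in> borel_measurable (borel \<Otimes>\<^sub>M D)" for c :: real
      by simp
    then show "(\<lambda>z. (F (fst z + inverse (real (Suc n)) *\<^sub>R i) (snd z) - F (fst z) (snd z)) / inverse (real (Suc n)))
        \<in> borel_measurable (borel \<Otimes>\<^sub>M D)"
      by measurable
  qed
  have "(\<lambda>z. \<Sum>i\<in>Basis. (sample_grad F (fst z) (snd z) \<bullet> i) *\<^sub>R i) \<in> borel_measurable (borel \<Otimes>\<^sub>M D)"
    using comp by measurable
  then show ?thesis by (simp add: euclidean_representation case_prod_beta')
qed

lemma (in prob_space) indep_vars_imp_indep_var:
  assumes ind: "indep_vars (\<lambda>_. N) X I" and ij: "i \<in> I" "j \<in> I" "i \<noteq> j"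
  shows "indep_var N (X i) N (X j)"
proof -
  have "indep_var N ((\<lambda>w. w i) \<circ> (\<lambda>\<omega>. restrict (\<lambda>i. X i \<omega>) {i})) N ((\<lambda>w. w j) \<circ> (\<lambda>\<omega>. restrict (\<lambda>i. X i \<omega>) {j}))"
    by (rule indep_var_compose[OF indep_var_restrict[OF ind]]) (use ij in auto)
  then show ?thesis by (simp add: comp_def)
qed

lemma (in prob_space) indep_inner_mean_zero:
  fixes X Y :: "'a \<Rightarrow> 'b::euclidean_space"
  assumes ind: "indep_var borel X borel Y" and X: "has_bochner_integral M X 0" and Y: "has_bochner_integral M Y 0"
  shows "has_bochner_integral M (\<lambda>\<omega>. X \<omega> \<bullet> Y \<omega>) 0"
proof -
  have "has_bochner_integral M (\<lambda>\<omega>. (X \<omega> \<bullet> i) * (Y \<omega> \<bullet> i)) 0" for i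
  proof -
    have ind': "indep_var borel (\<lambda>\<omega>. X \<omega> \<bullet> i) borel (\<lambda>\<omega>. Y \<omega> \<bullet> i)"
      using indep_var_compose[OF ind, of "\<lambda>x. x \<bullet> i" borel "\<lambda>x. x \<bullet> i" borel] by (simp add: comp_def)
    have i: "has_bochner_integral M (\<lambda>\<omega>. X \<omega> \<bullet> i) 0" "has_bochner_integral M (\<lambda>\<omega>. Y \<omega> \<bullet> i) 0"
      using has_bochner_integral_inner_left[OF X, of i] has_bochner_integral_inner_left[OF Y, of i] by auto
    then show ?thesis
      using indep_var_lebesgue_integral[OF ind'] indep_var_integrable[OF ind']
      by (auto simp: has_bochner_integral_iff)
  qed
  then have "has_bochner_integral M (\<lambda>\<omega>. \<Sum>i\<in>Basis. (X \<omega> \<bullet> i) * (Y \<omega> \<bullet> i)) (\<Sum>i\<in>(Basis::'b set). 0)"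
    by (intro has_bochner_integral_sum)
  then show ?thesis by (simp add: euclidean_inner[symmetric])
qed

text \<open>Independence and zero mean remove the cross terms, so of the B^2 products only the B
  diagonal ones remain; against the factor 1 / B^2 this gives the gain 1 / B.\<close>

lemma (in prob_space) norm_mean_square_le:
  fixes Y :: "nat \<Rightarrow> 'a \<Rightarrow> 'b::euclidean_space"
  assumes B: "B \<ge> 1"
    and ind: "\<And>j k. j < B \<Longrightarrow> k < B \<Longrightarrow> j \<noteq> k \<Longrightarrow> indep_var borel (Y j) borel (Y k)"
    and zero: "\<And>j. j < B \<Longrightarrow> has_bochner_integral M (Y j) 0"
    and sq: "\<And>j. j < B \<Longrightarrow> integrable M (\<lambda>\<omega>. (norm (Y j \<omega>))\<^sup>2)"
      "\<And>j. j < B \<Longrightarrow> (\<integral>\<omega>. (norm (Y j \<omega>))\<^sup>2 \<partial>M) \<le> V"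
  shows "integrable M (\<lambda>\<omega>. (norm ((1 / real B) *\<^sub>R (\<Sum>j<B. Y j \<omega>)))\<^sup>2)"
    and "(\<integral>\<omega>. (norm ((1 / real B) *\<^sub>R (\<Sum>j<B. Y j \<omega>)))\<^sup>2 \<partial>M) \<le> V / real B"
proof -
  have pair: "has_bochner_integral M (\<lambda>\<omega>. Y j \<omega> \<bullet> Y k \<omega>) (if j = k then (\<integral>\<omega>. (norm (Y j \<omega>))\<^sup>2 \<partial>M) else 0)"
    if "j < B" "k < B" for j k
    using indep_inner_mean_zero[OF ind zero zero, of j k] sq(1) that
    by (auto simp: has_bochner_integral_iff power2_norm_eq_inner)
  have S: "has_bochner_integral M (\<lambda>\<omega>. \<Sum>j<B. \<Sum>k<B. Y j \<omega> \<bullet> Y k \<omega>)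
      (\<Sum>j<B. \<Sum>k<B. if j = k then (\<integral>\<omega>. (norm (Y j \<omega>))\<^sup>2 \<partial>M) else 0)"
    by (intro has_bochner_integral_sum pair) auto
  have eq: "(norm ((1 / real B) *\<^sub>R (\<Sum>j<B. Y j \<omega>)))\<^sup>2 = (1 / real B)\<^sup>2 * (\<Sum>j<B. \<Sum>k<B. Y j \<omega> \<bullet> Y k \<omega>)" for \<omega>
    by (simp add: power_mult_distrib power2_norm_eq_inner inner_sum_left inner_sum_right power_divide)
      (auto intro!: sum.cong simp: power2_eq_square inner_commute)
  show "integrable M (\<lambda>\<omega>. (norm ((1 / real B) *\<^sub>R (\<Sum>j<B. Y j \<omega>)))\<^sup>2)"
    unfolding eq using S by (auto simp: has_bochner_integral_iff)
  have "(\<integral>\<omega>. (norm ((1 / real B) *\<^sub>R (\<Sum>j<B. Y j \<omega>)))\<^sup>2 \<partial>M) = (1 / real B)\<^sup>2 * (\<Sum>j<B. \<integral>\<omega>. (norm (Y j \<omega>))\<^sup>2 \<partial>M)"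
    unfolding eq using S by (simp add: has_bochner_integral_iff sum.delta)
  also have "\<dots> \<le> (1 / real B)\<^sup>2 * (\<Sum>j<B. V)"
    by (intro mult_left_mono sum_mono sq) auto
  also have "\<dots> = V / real B" using B by (simp add: power2_eq_square)
  finally show "(\<integral>\<omega>. (norm ((1 / real B) *\<^sub>R (\<Sum>j<B. Y j \<omega>)))\<^sup>2 \<partial>M) \<le> V / real B" .
qed

lemma law_preserving_integral:
  fixes v :: "'p \<Rightarrow> 'c::{banach, second_countable_topology}"
  assumes "X \<in> measurable M N" "distr M N X = N" "integrable N v"
  shows "integrable M (\<lambda>\<omega>. v (X \<omega>))" "(\<integral>\<omega>. v (X \<omega>) \<partial>M) = integral\<^sup>L N v"
  using integrable_distr[OF assms(1), of v] integral_distr[OF assms(1), of v] assms(2,3)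
  by (auto simp: borel_measurable_integrable)

text \<open>Here the base point x is fixed; the random iterate is substituted afterwards through
  \<open>indep_noise\<close>.\<close>

lemma batch_noise:
  fixes f :: "'a::euclidean_space \<Rightarrow> real" and t :: nat and x :: 'a
  assumes orc: "stochastic_oracle D F f \<sigma>" and iid: "iid_samples \<Omega> D (\<lambda>_. B) \<xi>" and B: "B \<ge> 1"
  defines "s \<equiv> \<lambda>\<omega>. batch_grad F B (\<lambda>j. \<xi> t j \<omega>) x - gradient f x"
  shows "has_bochner_integral \<Omega> s 0"
    and "integrable \<Omega> (\<lambda>\<omega>. (norm (s \<omega>))\<^sup>2)" "(\<integral>\<omega>. (norm (s \<omega>))\<^sup>2 \<partial>\<Omega>) \<le> \<sigma>\<^sup>2 / real B"
proof -
  interpret prob_space \<Omega> using iid by (simp add: iid_samples_def)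
  have ind: "indep_vars (\<lambda>_. D) (\<lambda>(t, j). \<xi> t j) (SIGMA t:UNIV. {..<B})"
    and distr: "\<And>j. j < B \<Longrightarrow> distr \<Omega> D (\<xi> t j) = D"
    using iid by (auto simp: iid_samples_def)
  have rv: "\<xi> t j \<in> measurable \<Omega> D" if "j < B" for j
    using ind that by (force simp: indep_vars_def)
  define u where "u p = sample_grad F x p - gradient f x" for p
  have hb: "has_bochner_integral D (sample_grad F x) (gradient f x)"
    and sq: "integrable D (\<lambda>p. (norm (u p))\<^sup>2)" "(\<integral>p. (norm (u p))\<^sup>2 \<partial>D) \<le> \<sigma>\<^sup>2" and pD: "prob_space D"
    using orc by (auto simp: stochastic_oracle_def u_def)
  interpret D: prob_space D by (rule pD)
  have u0: "integrable D u" "integral\<^sup>L D u = 0"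
    using hb by (auto simp: u_def[abs_def] has_bochner_integral_iff D.prob_space)
  have um: "u \<in> borel_measurable D" using u0(1) by (rule borel_measurable_integrable)
  note int = law_preserving_integral[OF rv distr]
  have Y: "indep_var borel (\<lambda>\<omega>. u (\<xi> t j \<omega>)) borel (\<lambda>\<omega>. u (\<xi> t k \<omega>))" if "j < B" "k < B" "j \<noteq> k" for j k
    using indep_var_compose[OF indep_vars_imp_indep_var[OF ind, of "(t, j)" "(t, k)"] um um] that
    by (simp add: comp_def)
  have zero: "has_bochner_integral \<Omega> (\<lambda>\<omega>. u (\<xi> t j \<omega>)) 0" if "j < B" for j
    using int[OF that that u0(1)] u0(2) by (simp add: has_bochner_integral_iff)
  have seq: "s \<omega> = (1 / real B) *\<^sub>R (\<Sum>j<B. u (\<xi> t j \<omega>))" for \<omega>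
    using B by (simp add: s_def batch_grad_def u_def sum_subtractf scaleR_diff_right sum_constant_scaleR)
  have "has_bochner_integral \<Omega> (\<lambda>\<omega>. (1 / real B) *\<^sub>R (\<Sum>j<B. u (\<xi> t j \<omega>))) ((1 / real B) *\<^sub>R (\<Sum>j<B. 0))"
    by (intro has_bochner_integral_scaleR_right has_bochner_integral_sum zero) auto
  then show "has_bochner_integral \<Omega> s 0" by (simp add: seq[abs_def])
  have V: "(\<integral>\<omega>. (norm (u (\<xi> t j \<omega>)))\<^sup>2 \<partial>\<Omega>) \<le> \<sigma>\<^sup>2" if "j < B" for j
    using int(2)[OF that that sq(1)] sq(2) by simp
  show "integrable \<Omega> (\<lambda>\<omega>. (norm (s \<omega>))\<^sup>2)" "(\<integral>\<omega>. (norm (s \<omega>))\<^sup>2 \<partial>\<Omega>) \<le> \<sigma>\<^sup>2 / real B"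
    unfolding seq using norm_mean_square_le[OF B Y zero int(1)[OF _ _ sq(1)] V] by auto
qed

text \<open>Conditionally on \<open>Z\<close>, the noise \<open>S (X Z, W)\<close> has mean zero and variance at most \<open>V\<close>;
  independence of \<open>Z\<close> and \<open>W\<close> reduces this to Fubini.\<close>

lemma (in prob_space) indep_noise:
  fixes S :: "'b::euclidean_space \<times> 'n \<Rightarrow> 'b" and u :: "'b \<Rightarrow> 'b"
  assumes ind: "indep_var N Z N' W"
    and X[measurable]: "X \<in> borel_measurable N"
    and S[measurable]: "S \<in> borel_measurable (borel \<Otimes>\<^sub>M N')"
    and u[measurable]: "u \<in> borel_measurable borel" and bdd: "\<And>x. norm (u x) \<le> b"
    and zero: "\<And>x. has_bochner_integral M (\<lambda>\<omega>. S (x, W \<omega>)) 0"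
    and sq: "\<And>x. integrable M (\<lambda>\<omega>. (norm (S (x, W \<omega>)))\<^sup>2)"
      "\<And>x. (\<integral>\<omega>. (norm (S (x, W \<omega>)))\<^sup>2 \<partial>M) \<le> V"
  shows "integrable M (\<lambda>\<omega>. (norm (S (X (Z \<omega>), W \<omega>)))\<^sup>2)"
    and "(\<integral>\<omega>. (norm (S (X (Z \<omega>), W \<omega>)))\<^sup>2 \<partial>M) \<le> V"
    and "has_bochner_integral M (\<lambda>\<omega>. S (X (Z \<omega>), W \<omega>) \<bullet> u (X (Z \<omega>))) 0"
proof -
  have Z[measurable]: "Z \<in> measurable M N" and W[measurable]: "W \<in> measurable M N'"
    and law: "distr M N Z \<Otimes>\<^sub>M distr M N' W = distr M (N \<Otimes>\<^sub>M N') (\<lambda>\<omega>. (Z \<omega>, W \<omega>))"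
    using ind by (auto simp: indep_var_distribution_eq)
  let ?\<mu> = "distr M N Z" and ?\<nu> = "distr M N' W"
  interpret \<mu>: prob_space ?\<mu> by (rule prob_space_distr) simp
  interpret \<nu>: prob_space ?\<nu> by (rule prob_space_distr) simp
  interpret \<mu>\<nu>: pair_prob_space ?\<mu> ?\<nu> ..
  have V0: "V \<ge> 0" using sq(2)[of undefined] by (rule order_trans[rotated]) simp
  \<comment> \<open>Integrability at the random point is still unknown, so Tonelli is applied to the
    nonnegative integral; finiteness then yields it.\<close>
  have Sn: "(\<integral>\<^sup>+\<omega>. ennreal ((norm (S (X (Z \<omega>), W \<omega>)))\<^sup>2) \<partial>M) \<le> ennreal V"
  proof -
    have "(\<integral>\<^sup>+\<omega>. ennreal ((norm (S (X (Z \<omega>), W \<omega>)))\<^sup>2) \<partial>M)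
        = (\<integral>\<^sup>+p. ennreal ((norm (S (X (fst p), snd p)))\<^sup>2) \<partial>(?\<mu> \<Otimes>\<^sub>M ?\<nu>))"
      unfolding law by (subst nn_integral_distr) auto
    also have "\<dots> = (\<integral>\<^sup>+z. \<integral>\<^sup>+w. ennreal ((norm (S (X z, w)))\<^sup>2) \<partial>?\<nu> \<partial>?\<mu>)"
      by (subst \<nu>.nn_integral_fst[symmetric]) simp_all
    also have "\<dots> \<le> (\<integral>\<^sup>+z. ennreal V \<partial>?\<mu>)"
    proof (rule nn_integral_mono)
      fix z
      have "(\<integral>\<^sup>+w. ennreal ((norm (S (X z, w)))\<^sup>2) \<partial>?\<nu>) = (\<integral>\<^sup>+\<omega>. ennreal ((norm (S (X z, W \<omega>)))\<^sup>2) \<partial>M)"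
        by (rule nn_integral_distr) auto
      also have "\<dots> = ennreal (\<integral>\<omega>. (norm (S (X z, W \<omega>)))\<^sup>2 \<partial>M)"
        by (rule nn_integral_eq_integral[OF sq(1)]) auto
      also have "\<dots> \<le> ennreal V" by (rule ennreal_leI[OF sq(2)])
      finally show "(\<integral>\<^sup>+w. ennreal ((norm (S (X z, w)))\<^sup>2) \<partial>?\<nu>) \<le> ennreal V" .
    qed
    also have "\<dots> = ennreal V" using \<mu>.emeasure_space_1 by simp
    finally show ?thesis .
  qed
  show int2: "integrable M (\<lambda>\<omega>. (norm (S (X (Z \<omega>), W \<omega>)))\<^sup>2)"
    using Sn by (intro integrableI_bounded) (auto intro: le_less_trans)
  show "(\<integral>\<omega>. (norm (S (X (Z \<omega>), W \<omega>)))\<^sup>2 \<partial>M) \<le> V"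
    using Sn V0 nn_integral_eq_integral[OF int2] by simp
  have int1: "integrable M (\<lambda>\<omega>. S (X (Z \<omega>), W \<omega>) \<bullet> u (X (Z \<omega>)))"
  proof (rule Bochner_Integration.integrable_bound)
    show "integrable M (\<lambda>\<omega>. (norm (S (X (Z \<omega>), W \<omega>)))\<^sup>2 + b\<^sup>2)" using int2 by simp
    show "AE \<omega> in M. norm (S (X (Z \<omega>), W \<omega>) \<bullet> u (X (Z \<omega>))) \<le> norm ((norm (S (X (Z \<omega>), W \<omega>)))\<^sup>2 + b\<^sup>2)"
    proof (rule AE_I2)
      fix \<omega>
      let ?s = "S (X (Z \<omega>), W \<omega>)" and ?u = "u (X (Z \<omega>))"
      have "\<bar>?s \<bullet> ?u\<bar> \<le> norm ?s * b"
        using Cauchy_Schwarz_ineq2[of ?s ?u] mult_left_mono[OF bdd, of "norm ?s" "X (Z \<omega>)"]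
        by simp
      also have "\<dots> \<le> (norm ?s)\<^sup>2 + b\<^sup>2"
        using sum_squares_bound[of "norm ?s" b] zero_le_power2[of "norm ?s"] zero_le_power2[of b] by linarith
      finally show "norm (?s \<bullet> ?u) \<le> norm ((norm ?s)\<^sup>2 + b\<^sup>2)" by simp
    qed
  qed measurable
  let ?g = "\<lambda>p. S (X (fst p), snd p) \<bullet> u (X (fst p))"
  have m: "?g \<in> borel_measurable (N \<Otimes>\<^sub>M N')" by measurable
  have "integrable (?\<mu> \<Otimes>\<^sub>M ?\<nu>) ?g"
    unfolding law using int1 m by (subst integrable_distr_eq) auto
  then have "(\<integral>z. \<integral>w. S (X z, w) \<bullet> u (X z) \<partial>?\<nu> \<partial>?\<mu>) = (\<integral>p. ?g p \<partial>(?\<mu> \<Otimes>\<^sub>M ?\<nu>))"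
    using \<mu>\<nu>.integral_fst'[of ?g] by simp
  also have "\<dots> = (\<integral>\<omega>. S (X (Z \<omega>), W \<omega>) \<bullet> u (X (Z \<omega>)) \<partial>M)"
    unfolding law using m by (subst integral_distr) auto
  finally have "(\<integral>\<omega>. S (X (Z \<omega>), W \<omega>) \<bullet> u (X (Z \<omega>)) \<partial>M) = (\<integral>z. \<integral>w. S (X z, w) \<bullet> u (X z) \<partial>?\<nu> \<partial>?\<mu>)" by simp
  also have "\<dots> = (\<integral>z. 0 \<partial>?\<mu>)"
  proof (rule Bochner_Integration.integral_cong[OF refl])
    fix z
    have "(\<integral>w. S (X z, w) \<bullet> u (X z) \<partial>?\<nu>) = (\<integral>\<omega>. S (X z, W \<omega>) \<bullet> u (X z) \<partial>M)"
      by (rule integral_distr) measurable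
    also have "\<dots> = 0" using has_bochner_integral_inner_left[OF zero[of "X z"], of "u (X z)"] by (auto simp: has_bochner_integral_iff)
    finally show "(\<integral>w. S (X z, w) \<bullet> u (X z) \<partial>?\<nu>) = 0" .
  qed
  finally show "has_bochner_integral M (\<lambda>\<omega>. S (X (Z \<omega>), W \<omega>) \<bullet> u (X (Z \<omega>))) 0"
    using int1 by (simp add: has_bochner_integral_iff)
qed

lemma batch_grad_measurable:
  fixes F :: "'a::euclidean_space \<Rightarrow> 'p \<Rightarrow> real"
  assumes orc: "stochastic_oracle D F f \<sigma>"
    and x: "x \<in> borel_measurable N" and p: "\<And>j. j < B \<Longrightarrow> p j \<in> measurable N D"
  shows "(\<lambda>\<omega>. batch_grad F B (\<lambda>j. p j \<omega>) (x \<omega>)) \<in> borel_measurable N"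
proof -
  have J: "(\<lambda>(x, p). sample_grad F x p) \<in> borel_measurable (borel \<Otimes>\<^sub>M D)"
    using orc by (intro sample_grad_jointly_measurable)
      (auto simp: stochastic_oracle_def has_bochner_integral_iff intro: borel_measurable_integrable)
  have "(\<lambda>\<omega>. sample_grad F (x \<omega>) (p j \<omega>)) \<in> borel_measurable N" if "j < B" for j
    using measurable_compose[OF measurable_Pair[OF x p[OF that]] J] by simp
  then show ?thesis unfolding batch_grad_def by (intro borel_measurable_scaleR borel_measurable_sum) auto
qed

lemma batch_grad_cong: "(\<And>j. j < B \<Longrightarrow> p j = q j) \<Longrightarrow> batch_grad F B p x = batch_grad F B q x"
  by (simp add: batch_grad_def)

text \<open>The iterate at time t depends on the batches before t only. The two sample spaces may
  differ, so the iteration can be replayed on a product space.\<close>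

lemma iterate_cong:
  assumes "\<And>s j. s < t \<Longrightarrow> j < b s \<Longrightarrow> \<xi> s j \<omega> = \<xi>' s j \<omega>'"
  shows "iterate M P h F \<gamma> \<alpha> b \<xi> x0 t \<omega> = iterate M P h F \<gamma> \<alpha> b \<xi>' x0 t \<omega>'"
  using assms
proof (induction t)
  case (Suc t)
  have "iterate M P h F \<gamma> \<alpha> b \<xi> x0 t \<omega> = iterate M P h F \<gamma> \<alpha> b \<xi>' x0 t \<omega>'"
    using Suc by simp
  moreover have "batch_grad F (b t) (\<lambda>j. \<xi> t j \<omega>) x = batch_grad F (b t) (\<lambda>j. \<xi>' t j \<omega>') x" for x
    using Suc.prems by (intro batch_grad_cong) simp
  ultimately show ?case by (simp add: Let_def)
qed simp

section \<open>Expected decrease and telescoping\<close>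

context projected_bregman
begin

lemma M_borel: "M \<in> sets borel"
  using M_compact by (simp add: compact_imp_closed borel_closed)

text \<open>Extended by 0 off M, where \<open>orth_proj\<close> onto \<open>T x\<close> is not known
  to be meaningful, to obtain a Borel function on the whole space.\<close>

definition tproj :: "'a \<Rightarrow> 'a \<Rightarrow> 'a" where
  "tproj x w = (if x \<in> M then orth_proj (T x) w else 0)"

text \<open>Expanding w in the basis reduces joint measurability to the projections of fixed basis
  vectors, which are Lipschitz in the base point on M.\<close>

lemma tproj_measurable:
  assumes [measurable]: "x \<in> borel_measurable Q" "w \<in> borel_measurable Q"
  shows "(\<lambda>\<omega>. tproj (x \<omega>) (w \<omega>)) \<in> borel_measurable Q"
proof -
  have [measurable]: "(\<lambda>x. indicator M x *\<^sub>R orth_proj (T x) i) \<in> borel_measurable borel" for i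
  proof (rule borel_measurable_continuous_on_indicator[OF M_borel])
    have "(2 * K * norm i)-lipschitz_on M (\<lambda>x. orth_proj (T x) i)"
      using orth_proj_tangent_lipschitz[of _ _ i] K_pos by (intro lipschitz_onI) (auto simp: dist_norm)
    then show "continuous_on M (\<lambda>x. orth_proj (T x) i)" by (rule lipschitz_on_continuous_on)
  qed
  have "tproj x w = (\<Sum>i\<in>Basis. (w \<bullet> i) *\<^sub>R (indicator M x *\<^sub>R orth_proj (T x) i))" for x w
  proof (cases "x \<in> M")
    case True
    have "orth_proj (T x) w = orth_proj (T x) (\<Sum>i\<in>Basis. (w \<bullet> i) *\<^sub>R i)" by (simp add: euclidean_representation)
    also have "\<dots> = (\<Sum>i\<in>Basis. (w \<bullet> i) *\<^sub>R orth_proj (T x) i)"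
      using linear_orth_proj[OF subspace_T[OF True]] by (simp add: linear_sum linear_cmul)
    finally show ?thesis using True by (simp add: tproj_def)
  qed (simp add: tproj_def)
  moreover have "(\<lambda>\<omega>. \<Sum>i\<in>Basis. (w \<omega> \<bullet> i) *\<^sub>R (indicator M (x \<omega>) *\<^sub>R orth_proj (T (x \<omega>)) i)) \<in> borel_measurable Q"
    by measurable
  ultimately show ?thesis by (simp only:)
qed

lemma step_measurable:
  assumes "g \<in> borel_measurable Q" "x \<in> borel_measurable Q"
  shows "(\<lambda>\<omega>. step (g \<omega>) (x \<omega>)) \<in> borel_measurable Q"
  using borel_measurable_continuous_on[OF continuous_step[OF continuous_gradient_h] borel_measurable_Pair[OF assms]]
  by simp

lemma gradient_f_measurable: "gradient f \<in> borel_measurable borel"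
  using Ck_on_1_gradient(2)[OF f_C1] by (rule borel_measurable_continuous_onI)

lemma f_continuous: "continuous_on UNIV f"
  using Ck_on_1_gradient(1)[OF f_C1]
  by (intro continuous_at_imp_continuous_on) (auto intro: differentiable_imp_continuous_within)

text \<open>A globally Borel extension of the stationarity step, which is only meaningful on \<open>M\<close>.\<close>

definition vext :: "'a \<Rightarrow> 'a" where
  "vext x = step (tproj x (gradient f x)) x"

lemma vext_eq: "x \<in> M \<Longrightarrow> vext x = vstep x"
  by (simp add: vext_def tproj_def stationarity_step_def)

lemma vext_measurable: "vext \<in> borel_measurable borel"
  unfolding vext_def by (intro step_measurable tproj_measurable gradient_f_measurable) auto

lemma vstep_le: "x \<in> M \<Longrightarrow> norm (vstep x) \<le> \<bar>Gf\<bar> / (\<gamma> * lam)"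
proof -
  assume x: "x \<in> M"
  have "norm (vstep x) \<le> norm (rgrad x) / (\<gamma> * lam)"
    by (simp add: stationarity_step_def norm_step_le)
  also have "\<dots> \<le> \<bar>Gf\<bar> / (\<gamma> * lam)"
    using rgrad_le[OF x] \<gamma>_pos lam_pos by (intro divide_right_mono) auto
  finally show ?thesis .
qed

abbreviation "iter F B \<xi> x0 \<equiv> iterate M P h F (\<lambda>_. \<gamma>) (\<lambda>_. \<alpha>) (\<lambda>_. B) \<xi> x0"

lemma iter_in: "x0 \<in> M \<Longrightarrow> iter F B \<xi> x0 t \<omega> \<in> M"
  by (cases t) (auto simp: Let_def P_in)

text \<open>The measure Q is arbitrary and only samples before t are required to be measurable, so
  the lemma covers both \<Omega> and the product space of past samples.\<close>

lemma iter_measurable: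
  fixes F :: "'a \<Rightarrow> 'p \<Rightarrow> real"
  assumes orc: "stochastic_oracle D F f \<sigma>" and x0: "x0 \<in> M"
    and \<xi>: "\<And>s j. s < t \<Longrightarrow> j < B \<Longrightarrow> \<xi> s j \<in> measurable Q D"
  shows "iter F B \<xi> x0 t \<in> borel_measurable Q"
  using \<xi>
proof (induction t)
  case 0
  have "iter F B \<xi> x0 0 = (\<lambda>_. x0)" by auto
  then show ?case by simp
next
  case (Suc t)
  have [measurable]: "iter F B \<xi> x0 t \<in> borel_measurable Q" using Suc by simp
  have [measurable]: "(\<lambda>\<omega>. batch_grad F B (\<lambda>j. \<xi> t j \<omega>) (iter F B \<xi> x0 t \<omega>)) \<in> borel_measurable Q"
    using Suc.prems by (intro batch_grad_measurable[OF orc]) auto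
  have [measurable]: "P \<in> borel_measurable borel" using near by (simp add: nearest_point_projection_def)
  have [measurable]: "(\<lambda>\<omega>. step (tproj (iter F B \<xi> x0 t \<omega>) (batch_grad F B (\<lambda>j. \<xi> t j \<omega>) (iter F B \<xi> x0 t \<omega>)))
      (iter F B \<xi> x0 t \<omega>)) \<in> borel_measurable Q"
    by (intro step_measurable tproj_measurable) measurable
  have "iter F B \<xi> x0 (Suc t) = (\<lambda>\<omega>. P (iter F B \<xi> x0 t \<omega> + \<alpha> *\<^sub>R
      step (tproj (iter F B \<xi> x0 t \<omega>) (batch_grad F B (\<lambda>j. \<xi> t j \<omega>) (iter F B \<xi> x0 t \<omega>))) (iter F B \<xi> x0 t \<omega>)))"
    using iter_in[OF x0, of F B \<xi> t] by (simp add: Let_def tproj_def fun_eq_iff)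
  then show ?case by simp
qed

lemma expected_descent:
  fixes F :: "'a \<Rightarrow> 'p \<Rightarrow> real" and \<Omega> :: "'w measure"
  assumes desc: "\<And>x s. x \<in> M \<Longrightarrow> f (P (x + \<alpha> *\<^sub>R step (orth_proj (T x) (gradient f x + s)) x))
      \<le> f x - c * (norm (vstep x))\<^sup>2 - \<alpha> * (s \<bullet> orth_proj (T x) (vstep x)) + C * (norm s)\<^sup>2"
    and C: "C \<ge> 0"
    and orc: "stochastic_oracle D F f \<sigma>" and iid: "iid_samples \<Omega> D (\<lambda>_. B) \<xi>" and B: "B \<ge> 1"
    and x0: "x0 \<in> M"
  shows "integrable \<Omega> (\<lambda>\<omega>. (norm (vstep (iter F B \<xi> x0 t \<omega>)))\<^sup>2)"
    and "(\<integral>\<omega>. f (iter F B \<xi> x0 (Suc t) \<omega>) \<partial>\<Omega>) + c * (\<integral>\<omega>. (norm (vstep (iter F B \<xi> x0 t \<omega>)))\<^sup>2 \<partial>\<Omega>)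
      \<le> (\<integral>\<omega>. f (iter F B \<xi> x0 t \<omega>) \<partial>\<Omega>) + C * (\<sigma>\<^sup>2 / real B)"
    and "integrable \<Omega> (\<lambda>\<omega>. f (iter F B \<xi> x0 t \<omega>))"
proof -
  interpret prob_space \<Omega> using iid by (simp add: iid_samples_def)
  have ind: "indep_vars (\<lambda>_. D) (\<lambda>(t, j). \<xi> t j) (SIGMA t:UNIV. {..<B})"
    using iid by (simp add: iid_samples_def)
  have rv: "\<xi> t j \<in> measurable \<Omega> D" if "j < B" for t j
    using ind that by (force simp: indep_vars_def)
  let ?X = "iter F B \<xi> x0"
  have Xm[measurable]: "?X t \<in> borel_measurable \<Omega>" for t
    using rv by (intro iter_measurable[OF orc x0])
  have Xin: "?X t \<omega> \<in> M" for t \<omega> by (rule iter_in[OF x0])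
  have v: "vstep (?X t \<omega>) = vext (?X t \<omega>)" for \<omega> by (simp add: vext_eq Xin)
  have [measurable]: "vext \<in> borel_measurable borel" by (rule vext_measurable)
  show intv: "integrable \<Omega> (\<lambda>\<omega>. (norm (vstep (?X t \<omega>)))\<^sup>2)"
  proof (rule integrable_const_bound[where B = "(\<bar>Gf\<bar> / (\<gamma> * lam))\<^sup>2"])
    show "AE \<omega> in \<Omega>. norm ((norm (vstep (?X t \<omega>)))\<^sup>2) \<le> (\<bar>Gf\<bar> / (\<gamma> * lam))\<^sup>2"
      using vstep_le[OF Xin] by (intro AE_I2) (simp add: power_mono)
    show "(\<lambda>\<omega>. (norm (vstep (?X t \<omega>)))\<^sup>2) \<in> borel_measurable \<Omega>" unfolding v by measurable
  qed
  have intf: "integrable \<Omega> (\<lambda>\<omega>. f (?X t \<omega>))" for t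
  proof -
    have "bounded (f ` M)"
      by (intro compact_imp_bounded compact_continuous_image M_compact continuous_on_subset[OF f_continuous]) simp
    then obtain b where "\<And>x. x \<in> M \<Longrightarrow> \<bar>f x\<bar> \<le> b" by (auto simp: bounded_iff)
    moreover have [measurable]: "f \<in> borel_measurable borel" using f_continuous by (rule borel_measurable_continuous_onI)
    ultimately show ?thesis using Xin by (intro integrable_const_bound[where B = b]) auto
  qed
  then show "integrable \<Omega> (\<lambda>\<omega>. f (?X t \<omega>))" .
  \<comment> \<open>Past and current samples occupy disjoint index blocks and are therefore
    independent. \<open>X'\<close> replays the iteration on the coordinates of a past, making the
    iterate a function of \<open>Z\<close> alone.\<close>
  let ?past = "{..<t} \<times> {..<B}" and ?now = "{t} \<times> {..<B}"
  define Z where "Z \<omega> = restrict (\<lambda>(t, j). \<xi> t j \<omega>) ?past" for \<omega>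
  define W where "W \<omega> = restrict (\<lambda>(t, j). \<xi> t j \<omega>) ?now" for \<omega>
  define X' where "X' = iter F B (\<lambda>s j w. w (s, j)) x0 t"
  define S where "S = (\<lambda>(x, w). batch_grad F B (\<lambda>j. w (t, j)) x - gradient f x)"
  have indZW: "indep_var (PiM ?past (\<lambda>_. D)) Z (PiM ?now (\<lambda>_. D)) W"
    using indep_var_restrict[OF ind, of ?past ?now] unfolding Z_def[abs_def] W_def[abs_def]
    by (auto simp: case_prod_beta')
  have X'm: "X' \<in> borel_measurable (PiM ?past (\<lambda>_. D))"
    unfolding X'_def by (rule iter_measurable[OF orc x0]) (auto intro: measurable_component_singleton)
  have X': "X' (Z \<omega>) = ?X t \<omega>" for \<omega>
    unfolding X'_def Z_def by (rule iterate_cong) auto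
  have Sm: "S \<in> borel_measurable (borel \<Otimes>\<^sub>M PiM ?now (\<lambda>_. D))"
  proof -
    have "(\<lambda>z. snd z (t, j)) \<in> measurable (borel \<Otimes>\<^sub>M PiM ?now (\<lambda>_. D)) D" if "j < B" for j
      using that by (intro measurable_compose[OF measurable_snd measurable_component_singleton]) auto
    then have "(\<lambda>z. batch_grad F B (\<lambda>j. snd z (t, j)) (fst z) - gradient f (fst z))
        \<in> borel_measurable (borel \<Otimes>\<^sub>M PiM ?now (\<lambda>_. D))"
      by (intro borel_measurable_diff batch_grad_measurable[OF orc]
          measurable_compose[OF measurable_fst gradient_f_measurable]) auto
    then show ?thesis by (simp add: S_def case_prod_beta')
  qed
  have SW: "S (x, W \<omega>) = batch_grad F B (\<lambda>j. \<xi> t j \<omega>) x - gradient f x" for x \<omega>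
    unfolding S_def W_def using batch_grad_cong[of B] by (auto intro!: batch_grad_cong)
  \<comment> \<open>The factor of the linear noise term as a bounded Borel function of the iterate;
    boundedness makes its product with the square-integrable noise integrable.\<close>
  define u where "u x = tproj x (vext x)" for x
  have um: "u \<in> borel_measurable borel" unfolding u_def by (intro tproj_measurable vext_measurable) simp
  have ub: "norm (u x) \<le> \<bar>Gf\<bar> / (\<gamma> * lam)" for x
    using norm_orth_proj_le[OF subspace_T, of x "vstep x"] vstep_le[of x] \<gamma>_pos lam_pos
    by (auto simp: u_def tproj_def vext_eq)
  define s where "s \<omega> = S (X' (Z \<omega>), W \<omega>)" for \<omega>
  have noise: "integrable \<Omega> (\<lambda>\<omega>. (norm (s \<omega>))\<^sup>2)" "(\<integral>\<omega>. (norm (s \<omega>))\<^sup>2 \<partial>\<Omega>) \<le> \<sigma>\<^sup>2 / real B"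
    "has_bochner_integral \<Omega> (\<lambda>\<omega>. s \<omega> \<bullet> u (X' (Z \<omega>))) 0"
    unfolding s_def
    by (rule indep_noise[OF indZW X'm Sm um ub]; unfold SW; rule batch_noise[OF orc iid B])+
  have pw: "f (?X (Suc t) \<omega>) \<le> f (?X t \<omega>) - c * (norm (vstep (?X t \<omega>)))\<^sup>2
      - \<alpha> * (s \<omega> \<bullet> u (X' (Z \<omega>))) + C * (norm (s \<omega>))\<^sup>2" for \<omega>
    using desc[OF Xin[of t \<omega>], of "s \<omega>"] Xin[of t \<omega>]
    by (simp add: Let_def s_def SW X' u_def tproj_def vext_eq)
  have "(\<integral>\<omega>. f (?X (Suc t) \<omega>) \<partial>\<Omega>) \<le> (\<integral>\<omega>. f (?X t \<omega>) - c * (norm (vstep (?X t \<omega>)))\<^sup>2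
      - \<alpha> * (s \<omega> \<bullet> u (X' (Z \<omega>))) + C * (norm (s \<omega>))\<^sup>2 \<partial>\<Omega>)"
    using noise intf intv pw by (intro integral_mono) (auto simp: has_bochner_integral_iff simp del: iterate.simps)
  also have "\<dots> = (\<integral>\<omega>. f (?X t \<omega>) \<partial>\<Omega>) - c * (\<integral>\<omega>. (norm (vstep (?X t \<omega>)))\<^sup>2 \<partial>\<Omega>)
      + C * (\<integral>\<omega>. (norm (s \<omega>))\<^sup>2 \<partial>\<Omega>)"
    using noise intf[of t] intv by (simp add: has_bochner_integral_iff)
  also have "C * (\<integral>\<omega>. (norm (s \<omega>))\<^sup>2 \<partial>\<Omega>) \<le> C * (\<sigma>\<^sup>2 / real B)"
    using noise(2) C by (rule mult_left_mono)
  finally show "(\<integral>\<omega>. f (?X (Suc t) \<omega>) \<partial>\<Omega>) + c * (\<integral>\<omega>. (norm (vstep (?X t \<omega>)))\<^sup>2 \<partial>\<Omega>)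
      \<le> (\<integral>\<omega>. f (?X t \<omega>) \<partial>\<Omega>) + C * (\<sigma>\<^sup>2 / real B)" by simp
qed

lemma average_stationarity:
  fixes F :: "'a \<Rightarrow> 'p \<Rightarrow> real" and \<Omega> :: "'w measure"
  assumes desc: "\<And>x s. x \<in> M \<Longrightarrow> f (P (x + \<alpha> *\<^sub>R step (orth_proj (T x) (gradient f x + s)) x))
      \<le> f x - c * (norm (vstep x))\<^sup>2 - \<alpha> * (s \<bullet> orth_proj (T x) (vstep x)) + C * (norm s)\<^sup>2"
    and c: "c > 0" and C: "C \<ge> 0"
    and orc: "stochastic_oracle D F f \<sigma>" and iid: "iid_samples \<Omega> D (\<lambda>_. B) \<xi>" and B: "B \<ge> 1"
    and x0: "x0 \<in> M" and n: "n \<ge> 1"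
  shows "(1 / real n) * (\<Sum>t<n. \<integral>\<omega>. (norm (vstep (iter F B \<xi> x0 t \<omega>)))\<^sup>2 \<partial>\<Omega>)
      \<le> (1 + C) / c * ((f x0 - Inf (f ` M)) / real n + \<sigma>\<^sup>2 / real B)"
proof -
  interpret prob_space \<Omega> using iid by (simp add: iid_samples_def)
  define E where "E t = (\<integral>\<omega>. f (iter F B \<xi> x0 t \<omega>) \<partial>\<Omega>)" for t
  define V where "V t = (\<integral>\<omega>. (norm (vstep (iter F B \<xi> x0 t \<omega>)))\<^sup>2 \<partial>\<Omega>)" for t
  define r where "r = \<sigma>\<^sup>2 / real B"
  have one: "E (Suc t) + c * V t \<le> E t + C * r" for t
    unfolding E_def V_def r_def by (rule expected_descent(2)[OF desc C orc iid B x0])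
  have tel: "E n + c * (\<Sum>t<n. V t) \<le> E 0 + real n * (C * r)" for n
  proof (induction n)
    case (Suc n)
    then show ?case using one[of n] by (simp add: algebra_simps)
  qed simp
  have E0: "E 0 = f x0" by (simp add: E_def prob_space)
  have "bdd_below (f ` M)"
    by (intro bounded_imp_bdd_below compact_imp_bounded compact_continuous_image M_compact
        continuous_on_subset[OF f_continuous]) simp
  then have inf: "Inf (f ` M) \<le> f x" if "x \<in> M" for x using that by (rule cINF_lower)
  have "Inf (f ` M) = (\<integral>\<omega>. Inf (f ` M) \<partial>\<Omega>)" by (simp add: prob_space)
  also have "\<dots> \<le> E n" unfolding E_def
    by (intro integral_mono expected_descent(3)[OF desc C orc iid B x0] inf iter_in[OF x0]) simp
  finally have ET: "Inf (f ` M) \<le> E n" .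
  define g where "g = f x0 - Inf (f ` M)"
  have g: "g \<ge> 0" using inf[OF x0] by (simp add: g_def)
  have r: "r \<ge> 0" by (simp add: r_def)
  have "c * (\<Sum>t<n. V t) \<le> g + real n * (C * r)" using tel[of n] E0 ET by (simp add: g_def)
  \<comment> \<open>The coefficients 1 of g and C of the noise are enlarged to the common value 1 +
    C, so that one constant serves both terms.\<close>
  also have "\<dots> \<le> (1 + C) * g + (1 + C) * (real n * r)"
    using g r C by (simp add: distrib_right)
  also have "\<dots> = real n * ((1 + C) * (g / real n + r))" using n by (simp add: field_simps)
  finally have "(\<Sum>t<n. V t) / real n \<le> (1 + C) * (g / real n + r) / c"
    using c n by (simp add: pos_divide_le_eq pos_le_divide_eq mult.commute mult.left_commute)
  then show ?thesis by (simp add: V_def g_def r_def)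
qed

end

theorem theorem5p2:
  fixes M :: "'a::euclidean_space set" and d :: nat
    and P :: "'a \<Rightarrow> 'a"
    and f h :: "'a \<Rightarrow> real"
    and lam L \<rho> M1 M2 M3 M4 \<gamma> \<alpha> :: real
  assumes "compact M" and "embedded_submanifold d M"
    and "Ck_on 1 UNIV f"
    and "Ck_on 2 UNIV h" and "lam > 0" and "strongly_convex lam h"
    and "L > 0" and "relatively_smooth L h f"
    and "nearest_point_projection M P"
    and "projection_constants M P \<rho> M1 M2 M3 M4"
    and "\<gamma> \<ge> L"
    and "0 < \<alpha>"
    and "\<alpha> \<le> \<gamma> * lam / (8 * (\<gamma> * Psi1 M h M2 M3 + Psi2 M f M1 M2 M3 M4))"
  shows "\<exists>C>0. \<forall>(D :: 'p measure) (F :: 'a \<Rightarrow> 'p \<Rightarrow> real) (\<Omega> :: 'w measure)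
            (\<xi> :: nat \<Rightarrow> nat \<Rightarrow> 'w \<Rightarrow> 'p) (\<sigma> :: real) (B :: nat) (T :: nat) (x0 :: 'a).
          \<sigma> > 0 \<longrightarrow> stochastic_oracle D F f \<sigma> \<longrightarrow>
          B \<ge> 1 \<longrightarrow> iid_samples \<Omega> D (\<lambda>_. B) \<xi> \<longrightarrow>
          T \<ge> 1 \<longrightarrow> x0 \<in> M \<longrightarrow>
          (let x = iterate M P h F (\<lambda>_. \<gamma>) (\<lambda>_. \<alpha>) (\<lambda>_. B) \<xi> x0;
               v = (\<lambda>t \<omega>. stationarity_step M f h \<gamma> (x t \<omega>))
           in (\<forall>t<T. integrable \<Omega> (\<lambda>\<omega>. (norm (v t \<omega>))\<^sup>2)) \<and>
              (1 / real T) * (\<Sum>t<T. \<integral>\<omega>. (norm (v t \<omega>))\<^sup>2 \<partial>\<Omega>)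
                \<le> C * ((f x0 - Inf (f ` M)) / real T + \<sigma>\<^sup>2 / real B))"
proof -
  interpret projected_bregman M d P \<rho> M1 M2 M3 M4 h lam \<gamma> f L \<alpha>
    using assms Ck_on_2_gradient(1)[OF assms(4)] by unfold_locales auto
  \<comment> \<open>Both constants are obtained before oracle, samples, \<sigma>, B, T and
    \<open>x0\<close> are fixed; this is the uniformity claimed for the constant in the
    rate.\<close>
  obtain c C where cC: "c > 0" "C \<ge> 0"
    and desc: "\<And>x s. x \<in> M \<Longrightarrow> f (P (x + \<alpha> *\<^sub>R step (orth_proj (T x) (gradient f x + s)) x))
      \<le> f x - c * (norm (vstep x))\<^sup>2 - \<alpha> * (s \<bullet> orth_proj (T x) (vstep x)) + C * (norm s)\<^sup>2"
    using noisy_descent by metis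
  show ?thesis
  proof (intro exI[of _ "(1 + C) / c"] conjI allI impI)
    show "(1 + C) / c > 0" using cC by simp
  qed (unfold Let_def, intro conjI allI impI expected_descent(1)[OF desc cC(2)] average_stationarity[OF desc cC])
qed

end
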